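(* Let $\Gamma$ be a finite simplicial graph with vertex labelling $f\colon V(\Gamma)\to\mathbb{N}_{\geq 2}\cup\{\infty\}$, and let $G_\Gamma$ be the associated graph product of non-trivial cyclic groups. Then ${\rm dl}(G_\Gamma)\in\{1,2,\infty\}$. In particular, if $\Gamma$ is not a join, then: (1) ${\rm dl}(G_\Gamma)=1$ if and only if $\Gamma$ has exactly one vertex, $V(\Gamma)=\{v_1\}$. (2) ${\rm dl}(G_\Gamma)=2$ if and only if $V(\Gamma)=\{v,w\}$ consists of exactly two vertices, $E(\Gamma)=\emptyset$ and $f(v)=f(w)=2$.
   Context: A (simplicial) graph $\Gamma=(V,E)$ consists of a non-empty set $V$ and a subset $E\subseteq\{\{v,w\}\mid v,w\in V, v\neq w\}$. $\Gamma$ is a join of two graphs $\Omega_1=(V_1,E_1)$ and $\Omega_2=(V_2,E_2)$ (each with non-empty vertex set) if both are induced subgraphs of $\Gamma$, $V$ is the disjoint union of $V_1$ and $V_2$, and $\{v,w\}\in E$ for every $(v,w)\in V_1\times V_2$; $\Gamma$ is "not a join" if no such decomposition exists. The graph product of cyclic groups is $$G_\Gamma=\langle V(\Gamma)\mid v^{f(v)}=1\text{ if }f(v)<\infty,\ vwv^{-1}w^{-1}=1\text{ whenever }\{v,w\}\in E(\Gamma)\rangle.$$ For a group $G$ put $G^{(0)}=G$ and $G^{(i+1)}=[G^{(i)},G^{(i)}]$. The derived length is ${\rm dl}(G)=\infty$ if $G^{(i)}\neq G^{(i+1)}$ for all $i\geq 0$, and otherwise ${\rm dl}(G)=\min\{i\mid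 G^{(i)}=G^{(i+1)}\}$ (so $G$ need not be solvable for ${\rm dl}(G)$ to be finite). *)

theory Defs
  imports "HOL-Algebra.Algebra" "HOL-Library.Extended_Nat"
begin

text \<open>
  Group presentations. A word over the generators and their formal inverses is a list
  of pairs: \<open>(x, True)\<close> stands for the generator \<open>x\<close> and \<open>(x, False)\<close> for its inverse.
\<close>

definition words :: "'a set \<Rightarrow> ('a \<times> bool) list set" where
  "words S = lists (S \<times> UNIV)"

inductive_set pres_rel :: "'a set \<Rightarrow> ('a \<times> bool) list set \<Rightarrow> (('a \<times> bool) list) rel"
  for S :: "'a set" and R :: "('a \<times> bool) list set" where
  refl: "u \<in> words S \<Longrightarrow> (u, u) \<in> pres_rel S R"
| sym: "(u, w) \<in> pres_rel S R \<Longrightarrow> (w, u) \<in> pres_rel S R"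
| trans: "(u, v) \<in> pres_rel S R \<Longrightarrow> (v, w) \<in> pres_rel S R \<Longrightarrow> (u, w) \<in> pres_rel S R"
| cancel: "u \<in> words S \<Longrightarrow> w \<in> words S \<Longrightarrow> x \<in> S
    \<Longrightarrow> (u @ [(x, b), (x, \<not> b)] @ w, u @ w) \<in> pres_rel S R"
| relator: "u \<in> words S \<Longrightarrow> w \<in> words S \<Longrightarrow> r \<in> R \<Longrightarrow> r \<in> words S
    \<Longrightarrow> (u @ r @ w, u @ w) \<in> pres_rel S R"

text \<open>The group \<open>\<langle>S | R\<rangle>\<close>, as words modulo free cancellation and deletion of relators.
  Elements of \<open>R\<close> that are not words over \<open>S\<close> are ignored.\<close>

definition presented_group ::
    "'a set \<Rightarrow> ('a \<times> bool) list set \<Rightarrow> ('a \<times> bool) list set monoid" where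
  "presented_group S R =
     \<lparr>carrier = words S // pres_rel S R,
      monoid.mult = (\<lambda>A B. \<Union>u\<in>A. \<Union>w\<in>B. pres_rel S R `` {u @ w}),
      one = pres_rel S R `` {[]}\<rparr>"

lemma pres_rel_words: "(u, w) \<in> pres_rel S R \<Longrightarrow> u \<in> words S \<and> w \<in> words S"
  by (induction rule: pres_rel.induct) (auto simp: words_def)

lemma equiv_pres_rel: "equiv (words S) (pres_rel S R)"
  by (rule equivI)
    (auto simp: refl_on_def sym_def trans_def dest: pres_rel_words
      intro: pres_rel.refl pres_rel.sym pres_rel.trans)

lemma pres_rel_context:
  assumes "(u, w) \<in> pres_rel S R" "p \<in> words S" "q \<in> words S"
  shows "(p @ u @ q, p @ w @ q) \<in> pres_rel S R"
  using assms(1)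
proof (induction rule: pres_rel.induct)
  case (refl u)
  then show ?case using assms by (auto intro!: pres_rel.refl simp: words_def)
next
  case (cancel u w x b)
  then show ?case
    using assms pres_rel.cancel[of "p @ u" S "w @ q" x b R] by (simp add: words_def)
next
  case (relator u w r)
  then show ?case
    using assms pres_rel.relator[of "p @ u" S "w @ q" r R] by (simp add: words_def)
qed (blast intro: pres_rel.sym pres_rel.trans)+

lemma pres_rel_append:
  assumes "(u, u') \<in> pres_rel S R" "(w, w') \<in> pres_rel S R"
  shows "(u @ w, u' @ w') \<in> pres_rel S R"
proof -
  have "(u @ w, u' @ w) \<in> pres_rel S R"
    using pres_rel_context[OF assms(1), of "[]" w] pres_rel_words[OF assms(2)]
    by (simp add: words_def)
  moreover have "(u' @ w, u' @ w') \<in> pres_rel S R"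
    using pres_rel_context[OF assms(2), of u' "[]"] pres_rel_words[OF assms(1)]
    by (simp add: words_def)
  ultimately show ?thesis by (rule pres_rel.trans)
qed

lemma presented_group_mult:
  assumes "u \<in> words S" "w \<in> words S"
  shows "pres_rel S R `` {u} \<otimes>\<^bsub>presented_group S R\<^esub> pres_rel S R `` {w} = pres_rel S R `` {u @ w}"
proof -
  have "congruent2 (pres_rel S R) (pres_rel S R) (\<lambda>u w. pres_rel S R `` {u @ w})"
    by (rule congruent2I') (use equiv_class_eq[OF equiv_pres_rel] pres_rel_append in blast)
  from UN_equiv_class2[OF equiv_pres_rel equiv_pres_rel this assms]
  show ?thesis by (simp add: presented_group_def)
qed

lemma group_presented_group: "group (presented_group S R)"
proof (rule groupI)
  let ?G = "presented_group S R" and ?c = "\<lambda>u. pres_rel S R `` {u}"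
  have car: "carrier ?G = ?c ` words S"
    by (auto simp: presented_group_def quotient_def)
  have one: "\<one>\<^bsub>?G\<^esub> = ?c []" by (simp add: presented_group_def)
  have nil: "[] \<in> words S" by (simp add: words_def)
  have app: "u @ w \<in> words S" if "u \<in> words S" "w \<in> words S" for u w
    using that by (simp add: words_def)
  show "x \<otimes>\<^bsub>?G\<^esub> y \<in> carrier ?G" if "x \<in> carrier ?G" "y \<in> carrier ?G" for x y
    using that by (auto simp: car presented_group_mult app)
  show "\<one>\<^bsub>?G\<^esub> \<in> carrier ?G" by (auto simp: car one nil)
  show "x \<otimes>\<^bsub>?G\<^esub> y \<otimes>\<^bsub>?G\<^esub> z = x \<otimes>\<^bsub>?G\<^esub> (y \<otimes>\<^bsub>?G\<^esub> z)"
    if "x \<in> carrier ?G" "y \<in> carrier ?G" "z \<in> carrier ?G" for x y z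
    using that by (auto simp: car presented_group_mult app)
  show "\<one>\<^bsub>?G\<^esub> \<otimes>\<^bsub>?G\<^esub> x = x" if "x \<in> carrier ?G" for x
    using that by (auto simp: car one presented_group_mult nil)
  show "\<exists>y\<in>carrier ?G. y \<otimes>\<^bsub>?G\<^esub> x = \<one>\<^bsub>?G\<^esub>" if "x \<in> carrier ?G" for x
  proof -
    have "\<exists>v\<in>words S. (v @ u, []) \<in> pres_rel S R" if "u \<in> words S" for u
      using that
    proof (induction u)
      case Nil
      then show ?case using nil pres_rel.refl by force
    next
      case (Cons a u)
      obtain x b where a: "a = (x, b)" by (cases a)
      with Cons obtain v where v: "v \<in> words S" "(v @ u, []) \<in> pres_rel S R"
        and x: "x \<in> S" "u \<in> words S"
        by (auto simp: words_def)
      have "(v @ [(x, \<not> b), (x, b)] @ u, v @ u) \<in> pres_rel S R"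
        using pres_rel.cancel[OF v(1) x(2,1), of "\<not> b"] by simp
      then have "((v @ [(x, \<not> b)]) @ a # u, []) \<in> pres_rel S R"
        using v(2) a by (auto intro: pres_rel.trans)
      moreover have "v @ [(x, \<not> b)] \<in> words S" using v x by (simp add: words_def)
      ultimately show ?case by blast
    qed
    with that show ?thesis
      using equiv_class_eq[OF equiv_pres_rel]
      by (fastforce simp: car one presented_group_mult)
  qed
qed

definition simplicial_graph :: "'a set \<Rightarrow> 'a set set \<Rightarrow> bool" where
  "simplicial_graph V E \<longleftrightarrow> V \<noteq> {} \<and> E \<subseteq> {{v, w} | v w. v \<in> V \<and> w \<in> V \<and> v \<noteq> w}"

definition induced_subgraph :: "'a set \<Rightarrow> 'a set set \<Rightarrow> 'a set \<Rightarrow> 'a set set \<Rightarrow> bool" where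
  "induced_subgraph V' E' V E \<longleftrightarrow>
     simplicial_graph V' E' \<and> V' \<subseteq> V \<and> E' = {e \<in> E. e \<subseteq> V'}"

definition is_join :: "'a set \<Rightarrow> 'a set set \<Rightarrow> bool" where
  "is_join V E \<longleftrightarrow> (\<exists>V1 E1 V2 E2.
     induced_subgraph V1 E1 V E \<and> induced_subgraph V2 E2 V E \<and>
     V = V1 \<union> V2 \<and> V1 \<inter> V2 = {} \<and> (\<forall>v\<in>V1. \<forall>w\<in>V2. {v, w} \<in> E))"

definition graph_product_relators ::
    "'a set \<Rightarrow> 'a set set \<Rightarrow> ('a \<Rightarrow> enat) \<Rightarrow> ('a \<times> bool) list set" where
  "graph_product_relators V E f =
     {replicate n (v, True) | v n. v \<in> V \<and> f v = enat n} \<union>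
     {[(v, True), (w, True), (v, False), (w, False)] | v w. {v, w} \<in> E}"

definition graph_product ::
    "'a set \<Rightarrow> 'a set set \<Rightarrow> ('a \<Rightarrow> enat) \<Rightarrow> ('a \<times> bool) list set monoid" where
  "graph_product V E f = presented_group V (graph_product_relators V E f)"

definition derived_series :: "('g, 'm) monoid_scheme \<Rightarrow> nat \<Rightarrow> 'g set" where
  "derived_series G i = (derived G ^^ i) (carrier G)"

text \<open>
  The derived length is the point where the derived series becomes stationary,
  not necessarily at the trivial subgroup.
\<close>

definition derived_length :: "('g, 'm) monoid_scheme \<Rightarrow> enat" where
  "derived_length G =
     (if \<exists>i. derived_series G i = derived_series G (Suc i)
      then enat (LEAST i. derived_series G i = derived_series G (Suc i))
      else \<infinity>)"

end

theory Submission
  imports Defs "HOL-Computational_Algebra.Formal_Power_Series" Complex_Main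
begin

text \<open>
  Call two distinct vertices independent if no edge joins them. If the independent pairs form a
  matching all of whose vertices have label \<open>2\<close>, then \<open>G\<close> is a product of cyclic groups and infinite
  dihedral groups: the products \<open>v w\<close> of matched generators generate an abelian normal subgroup with
  abelian quotient, so \<open>G''\<close> is trivial, and \<open>G'\<close> is trivial iff there is no independent pair.

  Otherwise there is an independent pair with labels not both \<open>2\<close>, or a vertex \<open>x\<close> independent of two
  others \<open>y\<close> and \<open>z\<close>, all with label \<open>2\<close>. Kill all other generators and map into the units of
  \<open>M\<^sub>3(\<complex>)[[t]]\<close>: one generator goes to a conjugate \<open>P D P\<^sup>-\<^sup>1\<close> of a diagonal matrix of the right order by
  \<open>P = 1 + t N\<close>, the others to constant diagonal matrices. The image is abelian modulo \<open>t\<close>, and a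
  commutator of units \<open>1 + O(t\<^sup>d)\<close> is \<open>1 + O(t\<^sup>2\<^sup>d)\<close>, so a stationary term of the derived series would be
  trivial. But the leading coefficient of a commutator is the Lie bracket of the leading coefficients,
  and two elements with leading coefficients spanning a suitable plane in \<open>sl\<^sub>2\<close> or \<open>so\<^sub>3\<close> produce, by
  iterated commutators, two elements of the next derived subgroup with the same property. Hence no
  term of the derived series is trivial and the derived length is infinite.
\<close>

section \<open>Homomorphisms from group presentations\<close>

fun eval_word :: "('g, 'm) monoid_scheme \<Rightarrow> ('a \<Rightarrow> 'g) \<Rightarrow> ('a \<times> bool) list \<Rightarrow> 'g" where
  "eval_word H g [] = \<one>\<^bsub>H\<^esub>"
| "eval_word H g ((x, b) # u) = (if b then g x else inv\<^bsub>H\<^esub> (g x)) \<otimes>\<^bsub>H\<^esub> eval_word H g u"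

context group
begin

lemma eval_word_closed:
  assumes "g ` S \<subseteq> carrier G" and "u \<in> words S"
  shows "eval_word G g u \<in> carrier G"
  using assms(2)
proof (induction u)
  case (Cons p u)
  obtain x b where "p = (x, b)" by (cases p)
  with Cons assms(1) show ?case by (auto simp: words_def)
qed simp

lemma eval_word_append:
  assumes "g ` S \<subseteq> carrier G" and "u \<in> words S" and "w \<in> words S"
  shows "eval_word G g (u @ w) = eval_word G g u \<otimes> eval_word G g w"
  using assms(2)
proof (induction u)
  case Nil
  then show ?case using eval_word_closed[OF assms(1,3)] by simp
next
  case (Cons p u)
  obtain x b where p: "p = (x, b)" by (cases p)
  with Cons.prems have u: "u \<in> words S" "g x \<in> carrier G"
    using assms(1) by (auto simp: words_def)
  then show ?case
    using Cons.IH eval_word_closed[OF assms(1)] assms(3) p by (simp add: m_assoc)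
qed

lemma eval_word_respects_pres_rel:
  assumes g: "g ` S \<subseteq> carrier G"
    and R: "\<And>r. r \<in> R \<Longrightarrow> r \<in> words S \<Longrightarrow> eval_word G g r = \<one>"
    and "(u, w) \<in> pres_rel S R"
  shows "eval_word G g u = eval_word G g w"
  using assms(3)
proof (induction rule: pres_rel.induct)
  case (cancel u w x b)
  have "[(x, b), (x, \<not> b)] \<in> words S" "g x \<in> carrier G"
    using cancel g by (auto simp: words_def)
  moreover from this have "eval_word G g [(x, b), (x, \<not> b)] = \<one>" by simp
  moreover have "[(x, b), (x, \<not> b)] @ w \<in> words S"
    using cancel calculation(1) by (simp add: words_def)
  ultimately show ?case
    using cancel eval_word_closed[OF g]
    by (simp only: eval_word_append[OF g] l_one)
next
  case (relator u w r)
  then have "r @ w \<in> words S" by (simp add: words_def)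
  with relator show ?case
    using R eval_word_closed[OF g] by (simp add: eval_word_append[OF g])
qed auto

end

definition generator_class :: "'a set \<Rightarrow> ('a \<times> bool) list set \<Rightarrow> 'a \<Rightarrow> ('a \<times> bool) list set" where
  "generator_class S R x = pres_rel S R `` {[(x, True)]}"

lemma carrier_presented_group:
  "carrier (presented_group S R) = (\<lambda>u. pres_rel S R `` {u}) ` words S"
  by (auto simp: presented_group_def quotient_def)

lemma one_presented_group: "\<one>\<^bsub>presented_group S R\<^esub> = pres_rel S R `` {[]}"
  by (simp add: presented_group_def)

lemma generator_class_closed: "x \<in> S \<Longrightarrow> generator_class S R x \<in> carrier (presented_group S R)"
  by (auto simp: carrier_presented_group generator_class_def words_def)

text \<open>This links words to group elements. Generation by the generator classes and the
  vanishing of relators both follow from it.\<close>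

lemma presented_group_eval_word:
  assumes "u \<in> words S"
  shows "eval_word (presented_group S R) (generator_class S R) u = pres_rel S R `` {u}"
  using assms
proof (induction u)
  case Nil
  then show ?case by (simp add: one_presented_group)
next
  case (Cons p u)
  let ?G = "presented_group S R"
  interpret G: group ?G by (rule group_presented_group)
  obtain x b where p: "p = (x, b)" by (cases p)
  with Cons.prems have u: "u \<in> words S" and x: "x \<in> S" by (auto simp: words_def)
  then have w: "[(x, c)] \<in> words S" for c by (simp add: words_def)
  have "inv\<^bsub>?G\<^esub> generator_class S R x = pres_rel S R `` {[(x, False)]}"
  proof (rule G.inv_equality)
    show "pres_rel S R `` {[(x, False)]} \<otimes>\<^bsub>?G\<^esub> generator_class S R x = \<one>\<^bsub>?G\<^esub>"
      using pres_rel.cancel[of "[]" S "[]" x False R] x w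
      by (simp add: generator_class_def presented_group_mult one_presented_group words_def
          equiv_class_eq_iff[OF equiv_pres_rel])
  qed (use x w generator_class_closed[OF x] in \<open>auto simp: carrier_presented_group\<close>)
  then have "(if b then generator_class S R x else inv\<^bsub>?G\<^esub> generator_class S R x)
      = pres_rel S R `` {[(x, b)]}"
    by (auto simp: generator_class_def)
  then show ?case using Cons.IH u w[of b] p by (simp add: presented_group_mult)
qed

lemma generate_generator_classes:
  "generate (presented_group S R) (generator_class S R ` S) = carrier (presented_group S R)"
    (is "generate ?G ?X = _")
proof
  interpret G: group ?G by (rule group_presented_group)
  show "generate ?G ?X \<subseteq> carrier ?G"
    by (intro G.generate_incl) (auto simp: generator_class_closed)
  have "eval_word ?G (generator_class S R) u \<in> generate ?G ?X" if "u \<in> words S" for u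
    using that
  proof (induction u)
    case Nil
    then show ?case by (simp add: generate.one)
  next
    case (Cons p u)
    obtain x b where p: "p = (x, b)" by (cases p)
    with Cons.prems have "x \<in> S" "u \<in> words S" by (auto simp: words_def)
    then show ?case
      using Cons.IH by (auto simp: p intro!: generate.eng intro: generate.incl generate.inv)
  qed
  then show "carrier ?G \<subseteq> generate ?G ?X"
    by (auto simp: carrier_presented_group presented_group_eval_word)
qed

text \<open>Von Dyck's theorem: a map on generators that kills the relators extends to a
  homomorphism on the presented group.\<close>

lemma (in group) presented_group_hom:
  assumes g: "g ` S \<subseteq> carrier G"
    and R: "\<And>r. r \<in> R \<Longrightarrow> r \<in> words S \<Longrightarrow> eval_word G g r = \<one>"
  obtains \<phi> where "group_hom (presented_group S R) G \<phi>"
    and "\<And>x. x \<in> S \<Longrightarrow> \<phi> (generator_class S R x) = g x"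
proof -
  \<comment> \<open>Evaluation is constant on each class, so the image of a class is a singleton and
    \<open>the_elem\<close> picks its value without choosing a representative.\<close>
  define \<phi> where "\<phi> A = the_elem (eval_word G g ` A)" for A
  have \<phi>: "\<phi> (pres_rel S R `` {u}) = eval_word G g u" if "u \<in> words S" for u
  proof -
    have "eval_word G g ` (pres_rel S R `` {u}) = {eval_word G g u}"
      using eval_word_respects_pres_rel[OF g R] pres_rel.refl[OF that] by fastforce
    then show ?thesis by (simp add: \<phi>_def)
  qed
  have app: "u @ w \<in> words S" if "u \<in> words S" "w \<in> words S" for u w
    using that by (simp add: words_def)
  have "\<phi> \<in> hom (presented_group S R) G"
    by (rule homI) (auto simp: carrier_presented_group presented_group_mult \<phi> app
        eval_word_closed[OF g] eval_word_append[OF g])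
  then have "group_hom (presented_group S R) G \<phi>"
    by (simp add: group_hom_def group_hom_axioms_def group_presented_group is_group)
  moreover have "\<phi> (generator_class S R x) = g x" if "x \<in> S" for x
    using that g \<phi>[of "[(x, True)]"] by (auto simp: generator_class_def words_def)
  ultimately show ?thesis by (rule that)
qed

lemma presented_group_relator:
  assumes "r \<in> R" and "r \<in> words S"
  shows "eval_word (presented_group S R) (generator_class S R) r = \<one>\<^bsub>presented_group S R\<^esub>"
  using pres_rel.relator[of "[]" S "[]" r R] assms
  by (simp add: presented_group_eval_word one_presented_group words_def
      equiv_class_eq_iff[OF equiv_pres_rel])

section \<open>Graph products: vertex generators and the universal property\<close>

abbreviation vertex_gen ::
    "'a set \<Rightarrow> 'a set set \<Rightarrow> ('a \<Rightarrow> enat) \<Rightarrow> 'a \<Rightarrow> ('a \<times> bool) list set" where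
  "vertex_gen V E f \<equiv> generator_class V (graph_product_relators V E f)"

lemma group_graph_product: "group (graph_product V E f)"
  by (simp add: graph_product_def group_presented_group)

lemma vertex_gen_closed: "v \<in> V \<Longrightarrow> vertex_gen V E f v \<in> carrier (graph_product V E f)"
  by (simp add: graph_product_def generator_class_closed)

lemma generate_vertex_gens:
  "generate (graph_product V E f) (vertex_gen V E f ` V) = carrier (graph_product V E f)"
  by (simp add: graph_product_def generate_generator_classes)

lemma (in group) eval_word_replicate:
  assumes "g x \<in> carrier G"
  shows "eval_word G g (replicate n (x, True)) = g x [^] n"
  using assms by (induction n) (simp_all, metis nat_pow_Suc nat_pow_Suc2)

lemma (in group) eval_word_commutator_eq_one_iff:
  assumes "g x \<in> carrier G" "g y \<in> carrier G"
  shows "eval_word G g [(x, True), (y, True), (x, False), (y, False)] = \<one>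
    \<longleftrightarrow> g x \<otimes> g y = g y \<otimes> g x"
proof -
  have "eval_word G g [(x, True), (y, True), (x, False), (y, False)] =
      (g x \<otimes> g y) \<otimes> inv (g y \<otimes> g x)"
    using assms by (simp add: m_assoc inv_mult_group)
  also have "\<dots> = \<one> \<longleftrightarrow> g x \<otimes> g y = g y \<otimes> g x"
    using assms by (metis inv_closed inv_equality inv_inv m_closed r_inv)
  finally show ?thesis .
qed

text \<open>Von Dyck's theorem for the two kinds of relators: powers for finite labels and
  commutators for edges. All representations below are built through it.\<close>

lemma (in group) graph_product_hom:
  assumes g: "\<And>v. v \<in> V \<Longrightarrow> g v \<in> carrier G"
    and pow: "\<And>v n. v \<in> V \<Longrightarrow> f v = enat n \<Longrightarrow> g v [^] n = \<one>"
    and com: "\<And>v w. v \<in> V \<Longrightarrow> w \<in> V \<Longrightarrow> {v, w} \<in> E \<Longrightarrow> g v \<otimes> g w = g w \<otimes> g v"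
  shows "\<exists>\<phi>. group_hom (graph_product V E f) G \<phi> \<and> (\<forall>v\<in>V. \<phi> (vertex_gen V E f v) = g v)"
proof -
  have "eval_word G g r = \<one>" if "r \<in> graph_product_relators V E f" and r: "r \<in> words V" for r
    using that(1) unfolding graph_product_relators_def
  proof (elim UnE CollectE exE conjE)
    fix v n assume "r = replicate n (v, True)" "v \<in> V" "f v = enat n"
    then show ?thesis using g pow by (simp add: eval_word_replicate)
  next
    fix v w assume *: "r = [(v, True), (w, True), (v, False), (w, False)]" "{v, w} \<in> E"
    with r have "v \<in> V" "w \<in> V" by (auto simp: words_def)
    with * show ?thesis
      using g com[of v w] eval_word_commutator_eq_one_iff[of g v w] by simp
  qed
  moreover have "g ` V \<subseteq> carrier G" using g by auto
  ultimately show ?thesis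
    using presented_group_hom[of g V "graph_product_relators V E f"]
    by (metis graph_product_def)
qed

lemma vertex_gen_pow:
  assumes "v \<in> V" and "f v = enat n"
  shows "vertex_gen V E f v [^]\<^bsub>graph_product V E f\<^esub> n = \<one>\<^bsub>graph_product V E f\<^esub>"
proof -
  interpret group "graph_product V E f" by (rule group_graph_product)
  have "replicate n (v, True) \<in> graph_product_relators V E f"
    using assms by (auto simp: graph_product_relators_def)
  moreover have "replicate n (v, True) \<in> words V" using assms by (auto simp: words_def)
  ultimately have "eval_word (graph_product V E f) (vertex_gen V E f) (replicate n (v, True))
      = \<one>\<^bsub>graph_product V E f\<^esub>"
    unfolding graph_product_def by (rule presented_group_relator)
  then show ?thesis using eval_word_replicate vertex_gen_closed[OF assms(1)] by metis
qed

lemma vertex_gen_commute: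
  assumes "v \<in> V" and "w \<in> V" and "{v, w} \<in> E"
  shows "vertex_gen V E f v \<otimes>\<^bsub>graph_product V E f\<^esub> vertex_gen V E f w =
    vertex_gen V E f w \<otimes>\<^bsub>graph_product V E f\<^esub> vertex_gen V E f v"
proof -
  interpret group "graph_product V E f" by (rule group_graph_product)
  let ?r = "[(v, True), (w, True), (v, False), (w, False)]"
  have "?r \<in> graph_product_relators V E f"
    using assms by (auto simp: graph_product_relators_def)
  moreover have "?r \<in> words V" using assms by (simp add: words_def)
  ultimately have "eval_word (graph_product V E f) (vertex_gen V E f) ?r = \<one>\<^bsub>graph_product V E f\<^esub>"
    unfolding graph_product_def by (rule presented_group_relator)
  then show ?thesis
    using eval_word_commutator_eq_one_iff[of "vertex_gen V E f" v w] vertex_gen_closed assms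
    by metis
qed

section \<open>Units of noncommutative power series rings and their leading terms\<close>

text \<open>Turns the units of a type-class ring into an HOL-Algebra group, so that power series
  over matrices can be the target of homomorphisms.\<close>

definition ring_units :: "'r::ring_1 monoid" where
  "ring_units = units_of \<lparr>carrier = UNIV, monoid.mult = (*), one = 1\<rparr>"

lemma ring_units_carrier: "x \<in> carrier ring_units \<longleftrightarrow> (\<exists>y. x * y = 1 \<and> y * x = 1)"
  by (auto simp: ring_units_def units_of_def Units_def)

lemma ring_units_mult [simp]: "x \<otimes>\<^bsub>ring_units\<^esub> y = x * y"
  by (simp add: ring_units_def units_of_def)

lemma ring_units_one [simp]: "\<one>\<^bsub>ring_units\<^esub> = 1"
  by (simp add: ring_units_def units_of_def)

lemma group_ring_units: "group (ring_units :: 'r::ring_1 monoid)"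
  unfolding ring_units_def
  by (rule monoid.units_group, rule monoidI) (auto simp: mult.assoc)

lemma ring_units_pow [simp]: "x [^]\<^bsub>ring_units\<^esub> (n::nat) = x ^ n"
  by (induction n) (simp_all add: nat_pow_def power_commutes)

lemma ring_units_inv:
  assumes "x \<in> carrier ring_units"
  shows "x * inv\<^bsub>ring_units\<^esub> x = 1" and "inv\<^bsub>ring_units\<^esub> x * x = 1"
  using group.r_inv[OF group_ring_units assms] group.l_inv[OF group_ring_units assms]
  by simp_all

lemma ring_units_inv_equality:
  assumes "x * y = 1" and "y * x = 1"
  shows "inv\<^bsub>ring_units\<^esub> x = y"
  by (rule group.inv_equality[OF group_ring_units]) (use assms in \<open>auto simp: ring_units_carrier\<close>)

text \<open>\<open>A\<close> may be zero, so this bounds the order of \<open>g - 1\<close> from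
  below by \<open>d\<close>. For \<open>d = 0\<close> it only says that the constant term of
  \<open>g\<close> is \<open>1 + A\<close>, which is why \<open>0 < d\<close> recurs below.\<close>

definition leading_term :: "nat \<Rightarrow> 'r::ring_1 \<Rightarrow> 'r fps \<Rightarrow> bool" where
  "leading_term d A g \<longleftrightarrow> (\<exists>u. g = 1 + fps_X ^ d * u \<and> fps_nth u 0 = A)"

text \<open>The variable is central even though the coefficients need not commute.\<close>

lemma fps_X_power_left_commute: "a * (fps_X ^ k * b) = fps_X ^ k * (a * (b :: 'r::ring_1 fps))"
  by (metis fps_mult_fps_X_power_commute mult.assoc)

lemma fps_X_power_mult_mult:
  "(fps_X ^ d * u) * (fps_X ^ e * w) = fps_X ^ (d + e) * (u * (w :: 'r::ring_1 fps))"
  by (simp add: fps_X_power_left_commute[of u] power_add mult.assoc)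

text \<open>Only the constant terms of \<open>g\<close> and \<open>g'\<close> meet \<open>A\<close>
  in degree \<open>d\<close>; their higher coefficients contribute beyond it.\<close>

lemma leading_term_conj:
  assumes "leading_term d A h" and "g * g' = 1"
  shows "leading_term d (fps_nth g 0 * A * fps_nth g' 0) (g * h * g')"
proof -
  from assms(1) obtain u where u: "h = 1 + fps_X ^ d * u" "fps_nth u 0 = A"
    by (auto simp: leading_term_def)
  have "g * h * g' = g * g' + g * (fps_X ^ d * u) * g'"
    by (simp add: u algebra_simps)
  also have "\<dots> = 1 + fps_X ^ d * (g * u * g')"
    using assms(2) by (simp add: fps_X_power_left_commute[of g] mult.assoc)
  finally show ?thesis
    using u(2) by (auto simp: leading_term_def intro!: exI[of _ "g * u * g'"])
qed

text \<open>The cross term of the product has order at least \<open>2 * d\<close>, which exceeds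
  \<open>d\<close> when \<open>d\<close> is positive.\<close>

lemma leading_term_mult:
  assumes "leading_term d A g" and "leading_term d B h" and "0 < d"
  shows "leading_term d (A + B) (g * h)"
proof -
  from assms obtain u w where "g = 1 + fps_X ^ d * u" "fps_nth u 0 = A"
      "h = 1 + fps_X ^ d * w" "fps_nth w 0 = B"
    by (auto simp: leading_term_def)
  then show ?thesis
    using assms(3) unfolding leading_term_def
    by (intro exI[of _ "u + w + u * (fps_X ^ d * w)"]) (simp add: algebra_simps)
qed

lemma leading_term_nth_0: "leading_term d A g \<Longrightarrow> 0 < d \<Longrightarrow> fps_nth g 0 = 1"
  by (auto simp: leading_term_def)

text \<open>From \<open>g * g' = 1\<close> one gets \<open>g' = 1 - fps_X ^ d * (u * g')\<close>,
  and \<open>g'\<close> has constant term 1.\<close>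

lemma leading_term_inverse:
  assumes "leading_term d A g" and "g * g' = 1" and "0 < d"
  shows "leading_term d (- A) g'"
proof -
  from assms obtain u where u: "g = 1 + fps_X ^ d * u" "fps_nth u 0 = A"
    by (auto simp: leading_term_def)
  have "fps_nth g 0 * fps_nth g' 0 = 1"
    using arg_cong[OF assms(2), of "\<lambda>x. fps_nth x 0"] by simp
  then have g0: "fps_nth g' 0 = 1"
    using leading_term_nth_0[OF assms(1,3)] by simp
  have "g' = 1 + fps_X ^ d * (- (u * g'))"
    using assms(2) by (simp add: u(1) algebra_simps eq_diff_eq)
  then show ?thesis
    using u g0 by (auto simp: leading_term_def intro!: exI[of _ "- (u * g')"])
qed

text \<open>The commutator equals \<open>1 + (g * h - h * g) * g' * h'\<close>. The constants 1 drop
  out of \<open>g * h - h * g\<close>, leaving \<open>fps_X ^ (d + e) * (u * w - w * u)\<close>, and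
  \<open>g'\<close>, \<open>h'\<close> have constant term 1.\<close>

lemma leading_term_commutator:
  assumes g: "leading_term d A g" and h: "leading_term e B h" and "0 < d" "0 < e"
    and inv: "g * g' = 1" "g' * g = 1" "h * h' = 1" "h' * h = 1"
  shows "leading_term (d + e) (A * B - B * A) (g * h * g' * h')"
proof -
  from g h obtain u w where u: "g = 1 + fps_X ^ d * u" "fps_nth u 0 = A"
      and w: "h = 1 + fps_X ^ e * w" "fps_nth w 0 = B"
    by (auto simp: leading_term_def)
  have "fps_nth g' 0 = 1" "fps_nth h' 0 = 1"
    using leading_term_nth_0[OF leading_term_inverse[OF g inv(1)]]
      leading_term_nth_0[OF leading_term_inverse[OF h inv(3)]] assms by auto
  moreover have "g * h - h * g = (fps_X ^ d * u) * (fps_X ^ e * w) - (fps_X ^ e * w) * (fps_X ^ d * u)"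
    unfolding u(1) w(1) by (simp add: distrib_left distrib_right)
  then have "g * h - h * g = fps_X ^ (d + e) * (u * w - w * u)"
    by (simp add: fps_X_power_mult_mult right_diff_distrib add.commute)
  moreover have "h * g * g' * h' = 1"
    by (metis inv mult.assoc mult_1_right)
  then have "g * h * g' * h' = 1 + (g * h - h * g) * g' * h'"
    by (simp add: algebra_simps)
  ultimately show ?thesis
    using u w unfolding leading_term_def
    by (intro exI[of _ "(u * w - w * u) * g' * h'"]) (simp add: mult.assoc)
qed

lemma geometric_inverse:
  fixes N :: "'r::ring_1"
  defines "Q \<equiv> Abs_fps (\<lambda>n. (- N) ^ n)"
  shows "(1 + fps_X * fps_const N) * Q = 1" and "Q * (1 + fps_X * fps_const N) = 1"
proof -
  have 1: "Q + fps_X * (fps_const N * Q) = 1"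
    by (rule fps_ext) (auto simp: Q_def gr0_conv_Suc)
  show "(1 + fps_X * fps_const N) * Q = 1"
    using 1 by (simp add: algebra_simps)
  have "Q + fps_X * (Q * fps_const N) = 1"
    by (rule fps_ext) (auto simp: Q_def gr0_conv_Suc power_commuting_commutes)
  then show "Q * (1 + fps_X * fps_const N) = 1"
    using fps_X_power_left_commute[of Q 1 "fps_const N"] by (simp add: algebra_simps)
qed

section \<open>X-adic congruence subgroups and their derived subgroups\<close>

text \<open>For \<open>d > 0\<close> this is the kernel of reduction modulo \<open>fps_X ^ d\<close>
  on units.\<close>

definition congruence_subgroup :: "nat \<Rightarrow> 'r::ring_1 fps set" where
  "congruence_subgroup d = {g \<in> carrier ring_units. \<exists>A. leading_term d A g}"

lemma subgroup_congruence_subgroup: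
  assumes "0 < d"
  shows "subgroup (congruence_subgroup d :: 'r::ring_1 fps set) ring_units"
proof -
  interpret group "ring_units :: 'r fps monoid" by (rule group_ring_units)
  show ?thesis
  proof (rule subgroupI)
    have "leading_term d 0 (1 :: 'r fps)"
      unfolding leading_term_def by (intro exI[of _ 0]) simp
    then show "congruence_subgroup d \<noteq> ({} :: 'r fps set)"
      using one_closed by (auto simp: congruence_subgroup_def)
  next
    fix a :: "'r fps" assume a: "a \<in> congruence_subgroup d"
    then show "inv\<^bsub>ring_units\<^esub> a \<in> congruence_subgroup d"
      using assms leading_term_inverse ring_units_inv(1)
      by (fastforce simp: congruence_subgroup_def)
  next
    fix a b :: "'r fps" assume "a \<in> congruence_subgroup d" "b \<in> congruence_subgroup d"
    then show "a \<otimes>\<^bsub>ring_units\<^esub> b \<in> congruence_subgroup d"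
      using assms leading_term_mult m_closed
      by (fastforce simp: congruence_subgroup_def)
  qed (auto simp: congruence_subgroup_def)
qed

lemma congruence_subgroup_antimono:
  assumes "d \<le> e"
  shows "congruence_subgroup e \<subseteq> congruence_subgroup d"
proof -
  have "fps_X ^ e * u = fps_X ^ d * (fps_X ^ (e - d) * u)" for u :: "'r::ring_1 fps"
    using assms by (simp add: mult.assoc[symmetric] power_add[symmetric])
  then show ?thesis
    by (fastforce simp: congruence_subgroup_def leading_term_def)
qed

text \<open>Commutators even reach level \<open>d + d\<close>; one level more is all that the
  induction on levels requires.\<close>

lemma derived_congruence_subgroup:
  fixes H :: "'r::ring_1 fps set"
  assumes "0 < d" and H: "H \<subseteq> congruence_subgroup d"
  shows "derived ring_units H \<subseteq> congruence_subgroup (Suc d)"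
proof -
  interpret group "ring_units :: 'r fps monoid" by (rule group_ring_units)
  have "g * h * inv\<^bsub>ring_units\<^esub> g * inv\<^bsub>ring_units\<^esub> h \<in> congruence_subgroup (Suc d)"
    if "g \<in> H" "h \<in> H" for g h
  proof -
    have gh: "g \<in> carrier ring_units" "h \<in> carrier ring_units"
      using that H by (auto simp: congruence_subgroup_def)
    from that H obtain A B where "leading_term d A g" "leading_term d B h"
      by (force simp: congruence_subgroup_def)
    then have "leading_term (d + d) (A * B - B * A)
        (g * h * inv\<^bsub>ring_units\<^esub> g * inv\<^bsub>ring_units\<^esub> h)"
      using assms(1) gh by (intro leading_term_commutator) (auto simp: ring_units_inv)
    moreover have "g * h * inv\<^bsub>ring_units\<^esub> g * inv\<^bsub>ring_units\<^esub> h \<in> carrier ring_units"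
      using gh m_closed inv_closed by (metis ring_units_mult)
    ultimately show ?thesis
      using congruence_subgroup_antimono[of "Suc d" "d + d"] assms(1)
      by (auto simp: congruence_subgroup_def)
  qed
  then show ?thesis
    unfolding derived_def
    by (intro generate_subgroup_incl subgroup_congruence_subgroup) auto
qed

text \<open>Taking constant terms is multiplicative, so a commutator of elements with commuting
  constant terms has constant term 1.\<close>

lemma derived_commuting_constant_terms:
  fixes H :: "'r::ring_1 fps set"
  assumes "H \<subseteq> carrier ring_units"
    and com: "\<And>g h. g \<in> H \<Longrightarrow> h \<in> H \<Longrightarrow> fps_nth g 0 * fps_nth h 0 = fps_nth h 0 * fps_nth g 0"
  shows "derived ring_units H \<subseteq> congruence_subgroup 1"
proof -
  interpret group "ring_units :: 'r fps monoid" by (rule group_ring_units)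
  have "g * h * inv\<^bsub>ring_units\<^esub> g * inv\<^bsub>ring_units\<^esub> h \<in> congruence_subgroup 1"
    if "g \<in> H" "h \<in> H" for g h
  proof -
    define c where "c = g * h * inv\<^bsub>ring_units\<^esub> g * inv\<^bsub>ring_units\<^esub> h"
    have gh: "g \<in> carrier ring_units" "h \<in> carrier ring_units" using that assms by auto
    have c: "c \<in> carrier ring_units"
      unfolding c_def using gh m_closed inv_closed by (metis ring_units_mult)
    \<comment> \<open>With the first two factors swapped the product is 1, and the constant term
      does not see the swap.\<close>
    have "h * g * inv\<^bsub>ring_units\<^esub> g * inv\<^bsub>ring_units\<^esub> h = 1"
      using ring_units_inv(1)[OF gh(1)] ring_units_inv(1)[OF gh(2)] by (simp add: mult.assoc)
    then have "fps_nth (h * g * inv\<^bsub>ring_units\<^esub> g * inv\<^bsub>ring_units\<^esub> h) 0 = 1" by simp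
    then have "fps_nth c 0 = 1"
      using com[OF that] by (simp add: c_def)
    then have "c = 1 + fps_X * fps_shift 1 c"
      by (intro fps_ext) auto
    then have "leading_term 1 (fps_nth c 1) c"
      unfolding leading_term_def by (intro exI[of _ "fps_shift 1 c"]) simp
    with c show ?thesis by (auto simp: congruence_subgroup_def c_def)
  qed
  then show ?thesis
    unfolding derived_def
    by (intro generate_subgroup_incl subgroup_congruence_subgroup) auto
qed

text \<open>The X-adic filtration is separated: level \<open>Suc n\<close> forces coefficient
  \<open>n\<close> to agree with that of 1.\<close>

lemma Inter_congruence_subgroups:
  assumes "\<And>d. 0 < d \<Longrightarrow> g \<in> congruence_subgroup d"
  shows "g = 1"
proof (rule fps_ext)
  fix n
  obtain u where "g = 1 + fps_X ^ Suc n * u"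
    using assms[of "Suc n"] by (auto simp: congruence_subgroup_def leading_term_def)
  then show "fps_nth g n = fps_nth 1 n"
    by (simp del: power_Suc add: fps_X_power_mult_nth)
qed

text \<open>Each passage to the derived subgroup gains a level, so a subgroup equal to its own
  derived subgroup lies in all levels.\<close>

lemma derived_stationary_trivial:
  fixes H :: "'r::ring_1 fps set"
  assumes H: "H \<subseteq> congruence_subgroup 1" and stat: "derived ring_units H = H"
  shows "H \<subseteq> {1}"
proof -
  have "H \<subseteq> congruence_subgroup (Suc d)" for d
  proof (induction d)
    case (Suc d)
    then show ?case using derived_congruence_subgroup[of "Suc d" H] stat by auto
  qed (use H in simp)
  then show ?thesis
    using Inter_congruence_subgroups by (metis Suc_pred subset_iff singletonI)
qed

text \<open>A pair in one term with leading coefficients \<open>A\<close>, \<open>B\<close> yields,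
  through its commutator \<open>c\<close>, the pair of commutators of \<open>c\<close> with
  \<open>g\<close> and with \<open>h\<close> in the next term. Both have degree
  \<open>3 * d\<close>, so a common degree is kept, and \<open>P\<close> is an invariant of this
  double bracket that the applications choose.\<close>

lemma leading_terms_in_derived_series:
  fixes H :: "'r::ring_1 fps set"
  assumes H: "subgroup H ring_units"
    and closed: "\<And>A B. P A B \<Longrightarrow>
      P ((A * B - B * A) * A - A * (A * B - B * A)) ((A * B - B * A) * B - B * (A * B - B * A))"
    and base: "P A0 B0" "0 < d0" "leading_term d0 A0 g0" "leading_term d0 B0 h0" "g0 \<in> H" "h0 \<in> H"
  shows "\<exists>A B d g h. P A B \<and> 0 < d \<and> leading_term d A g \<and> leading_term d B h \<and>
    g \<in> (derived ring_units ^^ n) H \<and> h \<in> (derived ring_units ^^ n) H"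
proof (induction n)
  case 0
  then show ?case using base by fastforce
next
  case (Suc n)
  interpret group "ring_units :: 'r fps monoid" by (rule group_ring_units)
  let ?D = "\<lambda>n. (derived ring_units ^^ n) H"
  have sub: "subgroup (?D n) ring_units" by (rule exp_of_derived_is_subgroup[OF H])
  then have D: "?D (Suc n) \<subseteq> ?D n" by (simp add: derived_incl)
  have comm: "a * b * inv\<^bsub>ring_units\<^esub> a * inv\<^bsub>ring_units\<^esub> b \<in> ?D (Suc n)"
    if "a \<in> ?D n" "b \<in> ?D n" for a b
    using that by (auto simp: derived_def intro!: generate.incl)
  have units: "a \<in> carrier ring_units" if "a \<in> ?D n" for a
    using that subgroup.subset[OF sub] by auto
  from Suc obtain A B d g h where *: "P A B" "0 < d" "leading_term d A g" "leading_term d B h"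
      "g \<in> ?D n" "h \<in> ?D n" by blast
  define c where "c = g * h * inv\<^bsub>ring_units\<^esub> g * inv\<^bsub>ring_units\<^esub> h"
  \<comment> \<open>Membership in the earlier term as well lets \<open>c\<close> be commuted with
    \<open>g\<close> and \<open>h\<close> there, at the cost of a single derived step.\<close>
  have c: "c \<in> ?D (Suc n)" "c \<in> ?D n" using comm[OF *(5,6)] D by (auto simp: c_def)
  have lc: "leading_term (d + d) (A * B - B * A) c"
    unfolding c_def using * units by (intro leading_term_commutator) (auto simp: ring_units_inv)
  have "leading_term (d + d + d) ((A * B - B * A) * A - A * (A * B - B * A))
      (c * g * inv\<^bsub>ring_units\<^esub> c * inv\<^bsub>ring_units\<^esub> g)"
    and "leading_term (d + d + d) ((A * B - B * A) * B - B * (A * B - B * A))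
      (c * h * inv\<^bsub>ring_units\<^esub> c * inv\<^bsub>ring_units\<^esub> h)"
    using lc * c units by (auto intro!: leading_term_commutator simp: ring_units_inv)
  moreover have "c * g * inv\<^bsub>ring_units\<^esub> c * inv\<^bsub>ring_units\<^esub> g \<in> ?D (Suc n)"
      "c * h * inv\<^bsub>ring_units\<^esub> c * inv\<^bsub>ring_units\<^esub> h \<in> ?D (Suc n)"
    using comm c * by auto
  ultimately show ?case
    using closed[OF *(1)] *(2) by (meson add_pos_pos)
qed

lemma leading_term_eq_zero: "leading_term d A 1 \<Longrightarrow> A = 0"
  unfolding leading_term_def by (metis add_cancel_left_right fps_nth_power_0 fps_zero_nth fps_X_power_mult_nth add.right_neutral diff_self_eq_0 less_irrefl)

section \<open>A filtration criterion for infinite derived length\<close>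

text \<open>A stationary term would have trivial image by the level argument, while the invariant
  \<open>P\<close> provides an element of that image with nonzero leading coefficient.\<close>

lemma derived_length_infinite:
  fixes G (structure) and \<phi> :: "'g \<Rightarrow> 'r::ring_1 fps"
  assumes hom: "group_hom G ring_units \<phi>"
    and com: "\<And>g h. g \<in> carrier G \<Longrightarrow> h \<in> carrier G \<Longrightarrow>
      fps_nth (\<phi> g) 0 * fps_nth (\<phi> h) 0 = fps_nth (\<phi> h) 0 * fps_nth (\<phi> g) 0"
    and closed: "\<And>A B. P A B \<Longrightarrow>
      P ((A * B - B * A) * A - A * (A * B - B * A)) ((A * B - B * A) * B - B * (A * B - B * A))"
    and nonzero: "\<And>A B. P A B \<Longrightarrow> A \<noteq> 0"
    and base: "P A0 B0" "0 < d0" "leading_term d0 A0 (\<phi> g0)" "leading_term d0 B0 (\<phi> h0)"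
      "g0 \<in> carrier G" "h0 \<in> carrier G"
  shows "derived_length G = \<infinity>"
proof -
  interpret group_hom G ring_units \<phi> by (rule hom)
  let ?D = "\<lambda>n. (derived ring_units ^^ n) (\<phi> ` carrier G)"
  have D: "?D n = \<phi> ` derived_series G n" for n
    unfolding derived_series_def by (rule exp_of_derived_img) simp
  have sub: "subgroup (\<phi> ` carrier G) ring_units" by (rule img_is_subgroup)
  have D1: "?D (Suc n) \<subseteq> congruence_subgroup 1" for n
  proof -
    have "?D n \<subseteq> \<phi> ` carrier G"
    proof (induction n)
      case (Suc n)
      have "?D (Suc n) \<subseteq> ?D n"
        using H.exp_of_derived_is_subgroup[OF sub, of n] by (simp add: H.derived_incl)
      with Suc show ?case by blast
    qed simp
    then have "?D (Suc n) \<subseteq> derived ring_units (\<phi> ` carrier G)"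
      by (simp add: H.mono_derived)
    also have "\<dots> \<subseteq> congruence_subgroup 1"
      by (rule derived_commuting_constant_terms) (use com subgroup.subset[OF sub] in auto)
    finally show ?thesis .
  qed
  have "derived_series G n \<noteq> derived_series G (Suc n)" for n
  proof
    assume eq: "derived_series G n = derived_series G (Suc n)"
    then have "derived ring_units (?D n) = ?D n" using D by (metis comp_apply funpow.simps(2))
    \<comment> \<open>The level one bound is available from term 1 on; stationarity identifies term
      \<open>n\<close> with term \<open>Suc n\<close>, which covers \<open>n = 0\<close>.\<close>
    moreover from this have "?D n \<subseteq> congruence_subgroup 1" using D1[of n] by simp
    ultimately have triv: "?D n \<subseteq> {1}" by (intro derived_stationary_trivial)
    obtain A B d g where *: "P A B" "leading_term d A g" "g \<in> ?D n"
      using leading_terms_in_derived_series[OF sub, of P A0 B0 d0 "\<phi> g0" "\<phi> h0" n] closed base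
      by blast
    with triv have "leading_term d A 1" by blast
    then have "A = 0" by (rule leading_term_eq_zero)
    with * nonzero show False by blast
  qed
  then show ?thesis by (simp add: derived_length_def)
qed

section \<open>Three by three matrices and two planes closed under the double bracket\<close>

datatype 'a mat3 = Mat3 'a 'a 'a 'a 'a 'a 'a 'a 'a

text \<open>Explicit entries make the matrix product the type-class multiplication that power series
  build on, and let simplification check matrix identities entry by entry.\<close>

instantiation mat3 :: (comm_ring_1) ring_1
begin

definition "0 = Mat3 0 0 0 0 0 0 0 0 0"
definition "1 = Mat3 1 0 0 0 1 0 0 0 1"

fun plus_mat3 where
  "Mat3 a1 a2 a3 b1 b2 b3 c1 c2 c3 + Mat3 x1 x2 x3 y1 y2 y3 z1 z2 z3 =
   Mat3 (a1 + x1) (a2 + x2) (a3 + x3) (b1 + y1) (b2 + y2) (b3 + y3) (c1 + z1) (c2 + z2) (c3 + z3)"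

fun uminus_mat3 where
  "- Mat3 a1 a2 a3 b1 b2 b3 c1 c2 c3 =
   Mat3 (- a1) (- a2) (- a3) (- b1) (- b2) (- b3) (- c1) (- c2) (- c3)"

fun minus_mat3 where
  "Mat3 a1 a2 a3 b1 b2 b3 c1 c2 c3 - Mat3 x1 x2 x3 y1 y2 y3 z1 z2 z3 =
   Mat3 (a1 - x1) (a2 - x2) (a3 - x3) (b1 - y1) (b2 - y2) (b3 - y3) (c1 - z1) (c2 - z2) (c3 - z3)"

fun times_mat3 where
  "Mat3 a1 a2 a3 b1 b2 b3 c1 c2 c3 * Mat3 x1 x2 x3 y1 y2 y3 z1 z2 z3 =
   Mat3 (a1 * x1 + a2 * y1 + a3 * z1) (a1 * x2 + a2 * y2 + a3 * z2) (a1 * x3 + a2 * y3 + a3 * z3)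
        (b1 * x1 + b2 * y1 + b3 * z1) (b1 * x2 + b2 * y2 + b3 * z2) (b1 * x3 + b2 * y3 + b3 * z3)
        (c1 * x1 + c2 * y1 + c3 * z1) (c1 * x2 + c2 * y2 + c3 * z2) (c1 * x3 + c2 * y3 + c3 * z3)"

instance
proof
  fix a b c :: "'a mat3"
  show "a * b * c = a * (b * c)" "a + b + c = a + (b + c)" "a + b = b + a" "0 + a = a"
    "- a + a = 0" "a - b = a + - b" "1 * a = a" "a * 1 = a"
    "(a + b) * c = a * c + b * c" "a * (b + c) = a * b + a * c" "(0 :: 'a mat3) \<noteq> 1"
    by (cases a; cases b; cases c; simp add: zero_mat3_def one_mat3_def algebra_simps)+
qed

end

definition diag3 :: "'a::comm_ring_1 \<Rightarrow> 'a \<Rightarrow> 'a \<Rightarrow> 'a mat3" where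
  "diag3 a b c = Mat3 a 0 0 0 b 0 0 0 c"

lemma diag3_mult: "diag3 a b c * diag3 a' b' c' = diag3 (a * a') (b * b') (c * c')"
  by (simp add: diag3_def)

lemma diag3_one: "diag3 1 1 1 = 1"
  by (simp add: diag3_def one_mat3_def)

lemma diag3_power: "diag3 a b c ^ n = diag3 (a ^ n) (b ^ n) (c ^ n)"
  by (induction n) (simp_all add: diag3_one diag3_mult)

text \<open>The off-diagonal part of \<open>sl_2\<close> in the upper left block, complementary to
  its diagonal Cartan subalgebra.\<close>

definition sl2_plane :: "'a::comm_ring_1 \<Rightarrow> 'a \<Rightarrow> 'a mat3" where
  "sl2_plane a b = Mat3 0 a 0 b 0 0 0 0 0"

text \<open>The skew-symmetric matrices supported on the third row and column, complementary to
  \<open>so_2\<close> in \<open>so_3\<close>.\<close>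

definition so3_plane :: "'a::comm_ring_1 \<Rightarrow> 'a \<Rightarrow> 'a mat3" where
  "so3_plane a b = Mat3 0 0 a 0 0 b (- a) (- b) 0"

text \<open>The determinant condition says that \<open>A\<close> and \<open>B\<close> are linearly
  independent. This is the invariant of the iteration.\<close>

definition spans_plane ::
    "(complex \<Rightarrow> complex \<Rightarrow> complex mat3) \<Rightarrow> complex mat3 \<Rightarrow> complex mat3 \<Rightarrow> bool" where
  "spans_plane L A B \<longleftrightarrow> (\<exists>a b c d. A = L a b \<and> B = L c d \<and> a * d \<noteq> b * c)"

text \<open>\<open>W\<close> is \<delta> times the diagonal matrix with entries 1, -1, 0, which acts
  on the two coordinates of the plane with eigenvalues 2 and -2.\<close>

lemma sl2_plane_bracket:
  fixes a b c d :: "'a::comm_ring_1"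
  defines "\<delta> \<equiv> a * d - b * c"
  defines "W \<equiv> sl2_plane a b * sl2_plane c d - sl2_plane c d * sl2_plane a b"
  shows "W * sl2_plane x y - sl2_plane x y * W = sl2_plane (2 * \<delta> * x) (- 2 * \<delta> * y)"
  by (simp add: W_def \<delta>_def sl2_plane_def algebra_simps)

text \<open>\<open>W\<close> is \<delta> times the infinitesimal rotation of the first two axes,
  which turns the plane by a right angle.\<close>

lemma so3_plane_bracket:
  fixes a b c d :: "'a::comm_ring_1"
  defines "\<delta> \<equiv> a * d - b * c"
  defines "W \<equiv> so3_plane a b * so3_plane c d - so3_plane c d * so3_plane a b"
  shows "W * so3_plane x y - so3_plane x y * W = so3_plane (- \<delta> * y) (\<delta> * x)"
  by (simp add: W_def \<delta>_def so3_plane_def algebra_simps)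

lemma spans_plane_nonzero:
  assumes "spans_plane L A B" and "L = sl2_plane \<or> L = so3_plane"
  shows "A \<noteq> 0"
  using assms by (auto simp: spans_plane_def sl2_plane_def so3_plane_def zero_mat3_def)

text \<open>Bracketing with \<open>A * B - B * A\<close> is invertible on the plane, with
  determinant \<open>- 4 * \<delta> ^ 2\<close> for \<open>sl2_plane\<close> and
  \<open>\<delta> ^ 2\<close> for \<open>so3_plane\<close>. The new pair thus has determinant
  \<open>- 4 * \<delta> ^ 3\<close> or \<open>\<delta> ^ 3\<close>.\<close>

lemma spans_plane_bracket:
  assumes "spans_plane L A B" and L: "L = sl2_plane \<or> L = so3_plane"
  shows "spans_plane L ((A * B - B * A) * A - A * (A * B - B * A))
    ((A * B - B * A) * B - B * (A * B - B * A))"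
proof -
  from assms(1) obtain a b c d where *: "A = L a b" "B = L c d" "a * d \<noteq> b * c"
    by (auto simp: spans_plane_def)
  define \<delta> where "\<delta> = a * d - b * c"
  have "(2 * \<delta> * a) * (- 2 * \<delta> * d) - (- 2 * \<delta> * b) * (2 * \<delta> * c) = - 4 * \<delta> ^ 3"
    and "(- \<delta> * b) * (\<delta> * c) - (\<delta> * a) * (- \<delta> * d) = \<delta> ^ 3"
    by (simp_all add: \<delta>_def power3_eq_cube algebra_simps)
  moreover have "\<delta> ^ 3 \<noteq> 0" using *(3) by (simp add: \<delta>_def)
  ultimately have "(2 * \<delta> * a) * (- 2 * \<delta> * d) \<noteq> (- 2 * \<delta> * b) * (2 * \<delta> * c)"
    and "(- \<delta> * b) * (\<delta> * c) \<noteq> (\<delta> * a) * (- \<delta> * d)"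
    by (metis eq_iff_diff_eq_0 mult_eq_0_iff neg_equal_0_iff_equal zero_neq_numeral, metis eq_iff_diff_eq_0)
  moreover have "A * B - B * A = L a b * L c d - L c d * L a b" by (simp add: *)
  ultimately show ?thesis
    using L sl2_plane_bracket[of a b c d] so3_plane_bracket[of a b c d]
    unfolding spans_plane_def *(1,2) \<delta>_def[symmetric] by fast
qed

text \<open>The twisted generator \<open>b = P D P\<^sup>-\<^sup>1\<close> agrees with \<open>D\<close> to order \<open>0\<close>, so its commutator with
  a constant \<open>a\<close> commuting with \<open>D\<close> is that of \<open>a\<close> with \<open>m = b D\<^sup>-\<^sup>1\<close>.\<close>

lemma leading_term_twisted_commutator:
  fixes a a' D D' N :: "'r::ring_1"
  assumes P: "P * P' = 1" "P' * P = 1" "leading_term 1 N P"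
    and D: "D * D' = 1" "D' * D = 1" and a: "a * a' = 1" "a' * a = 1" and com: "a * D = D * a"
  defines "M \<equiv> N - D * N * D'"
  shows "leading_term 1 (a * M * a' - M)
    (fps_const a * (P * fps_const D * P') * fps_const a' * (P * fps_const D' * P'))"
proof -
  let ?c = fps_const
  \<comment> \<open>Grouped as \<open>P\<close> times the conjugate of \<open>P'\<close> by
    \<open>D\<close>, so that the coefficient \<open>N - D * N * D'\<close> can be read off;
    \<open>m'\<close> is the inverse.\<close>
  define m where "m = P * (?c D * P' * ?c D')"
  define m' where "m' = ?c D * (P * (?c D' * P'))"
  have DD: "?c D * ?c D' = 1" "?c D' * ?c D = 1"
    using D by simp_all
  have DX: "?c D' * (?c D * u) = u" for u
    using DD by (metis mult.assoc mult_1)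
  have DY: "?c D * (?c D' * u) = u" for u
    using DD by (metis mult.assoc mult_1)
  have PX: "P' * (P * u) = u" for u
    using P by (metis mult.assoc mult_1)
  have "leading_term 1 (- N) P'" using leading_term_inverse[OF P(3,1)] by simp
  then have "leading_term 1 (D * (- N) * D') (?c D * P' * ?c D')"
    using leading_term_conj[of 1 "- N" P' "?c D" "?c D'"] DD by simp
  from leading_term_mult[OF P(3) this] have m: "leading_term 1 M m"
    by (simp add: m_def M_def)
  have "m * m' = 1"
    by (simp add: m_def m'_def mult.assoc DX DY PX P)
  then have m': "leading_term 1 (- M) m'"
    using leading_term_inverse[OF m] by simp
  have "leading_term 1 (a * M * a') (?c a * m * ?c a')"
    using leading_term_conj[OF m, of "?c a" "?c a'"] a by simp
  from leading_term_mult[OF this m'] have "leading_term 1 (a * M * a' - M) (?c a * m * ?c a' * m')"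
    by simp
  moreover have "a' * D = D * a'"
    using a com by (metis mult.assoc mult_1_left mult_1_right)
  then have a'D: "?c a' * (?c D * u) = ?c D * (?c a' * u)" for u
    by (simp add: mult.assoc[symmetric])
  \<comment> \<open>Here \<open>P * ?c D * P'\<close> is \<open>m * ?c D\<close> and
    \<open>P * ?c D' * P'\<close> is \<open>?c D' * m'\<close>; the factor \<open>?c D\<close> moves
    past \<open>?c a'\<close> and cancels.\<close>
  have "?c a * m * ?c a' * m' = ?c a * (P * ?c D * P') * ?c a' * (P * ?c D' * P')"
    by (simp add: m_def m'_def mult.assoc a'D DX del: fps_const_mult)
  ultimately show ?thesis by simp
qed

section \<open>Twisted diagonal representations of graph products\<close>

definition group_commutator :: "('g, 'm) monoid_scheme \<Rightarrow> 'g \<Rightarrow> 'g \<Rightarrow> 'g" where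
  "group_commutator G x y = x \<otimes>\<^bsub>G\<^esub> y \<otimes>\<^bsub>G\<^esub> inv\<^bsub>G\<^esub> x \<otimes>\<^bsub>G\<^esub> inv\<^bsub>G\<^esub> y"

lemma (in group) group_commutator_closed:
  "x \<in> carrier G \<Longrightarrow> y \<in> carrier G \<Longrightarrow> group_commutator G x y \<in> carrier G"
  by (simp add: group_commutator_def)

lemma group_commutator_in_derived:
  "x \<in> H \<Longrightarrow> y \<in> H \<Longrightarrow> group_commutator G x y \<in> derived G H"
  by (auto simp: group_commutator_def derived_def intro!: generate.incl)

section \<open>Commutation and derived subgroups tested on generators\<close>

text \<open>Two rounds of the centralizer argument: generated elements commute with each generator,
  hence with each other.\<close>

lemma (in group) generate_commute:
  assumes S: "S \<subseteq> carrier G"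
    and com: "\<And>x y. x \<in> S \<Longrightarrow> y \<in> S \<Longrightarrow> x \<otimes> y = y \<otimes> x"
    and "x \<in> generate G S" and "y \<in> generate G S"
  shows "x \<otimes> y = y \<otimes> x"
proof -
  have *: "a \<otimes> b = b \<otimes> a"
    if "a \<in> generate G S" "b \<in> carrier G" "\<And>s. s \<in> S \<Longrightarrow> s \<otimes> b = b \<otimes> s" for a b
    using that(1)
  proof (induction rule: generate.induct)
    case (inv h)
    then have "h \<in> carrier G" "h \<otimes> b = b \<otimes> h" using S that by auto
    then show ?case using that(2)
      by (metis inv_closed inv_solve_left inv_solve_right m_assoc m_closed)
  next
    case (eng h1 h2)
    then have "h1 \<in> carrier G" "h2 \<in> carrier G" using generate_in_carrier[OF S] by auto
    then show ?case using eng.IH that(2) by (metis m_assoc)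
  qed (use that in auto)
  have "s \<otimes> y = y \<otimes> s" if "s \<in> S" for s
    using *[OF assms(4), of s] that S com by force
  then show ?thesis using *[OF assms(3)] generate_in_carrier[OF S assms(4)] by blast
qed

lemma (in group_hom) images_commute_if_generators_commute:
  assumes S: "generate G S = carrier G" "S \<subseteq> carrier G"
    and com: "\<And>x y. x \<in> S \<Longrightarrow> y \<in> S \<Longrightarrow> h x \<otimes>\<^bsub>H\<^esub> h y = h y \<otimes>\<^bsub>H\<^esub> h x"
    and "x \<in> carrier G" "y \<in> carrier G"
  shows "h x \<otimes>\<^bsub>H\<^esub> h y = h y \<otimes>\<^bsub>H\<^esub> h x"
proof (rule H.generate_commute)
  show "h ` S \<subseteq> carrier H" using S(2) by auto
  show "h x \<in> generate H (h ` S)" "h y \<in> generate H (h ` S)"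
    using generate_img[OF S(2)] S(1) assms(4,5) by auto
qed (use com in auto)

text \<open>The quotient by \<open>A\<close> is generated by commuting cosets, hence abelian, so
  \<open>A\<close> contains the derived subgroup.\<close>

lemma (in group) derived_subset_if_generators_commute_mod:
  assumes A: "A \<lhd> G" and S: "generate G S = carrier G" "S \<subseteq> carrier G"
    and com: "\<And>x y. x \<in> S \<Longrightarrow> y \<in> S \<Longrightarrow> x \<otimes> y \<otimes> inv x \<otimes> inv y \<in> A"
  shows "derived G (carrier G) \<subseteq> A"
proof (rule derived_minimal[OF A])
  interpret A: normal A G by (rule A)
  interpret Q: group "G Mod A" by (rule A.factorgroup_is_group)
  interpret group_hom G "G Mod A" "\<lambda>x. A #> x"
    by unfold_locales (rule A.r_coset_hom_Mod)
  have eq: "A #> (x \<otimes> y) = A #> (y \<otimes> x)" if "x \<in> S" "y \<in> S" for x y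
  proof (rule repr_independence[symmetric])
    have xy: "x \<in> carrier G" "y \<in> carrier G" using that S by auto
    have "x \<otimes> y = (x \<otimes> y \<otimes> inv x \<otimes> inv y) \<otimes> (y \<otimes> x)"
      using xy l_inv[of "y \<otimes> x"] by (simp add: inv_mult_group m_assoc)
    then show "x \<otimes> y \<in> A #> (y \<otimes> x)"
      using com[OF that] unfolding r_coset_def by blast
    show "y \<otimes> x \<in> carrier G" using xy by simp
  qed (rule A.subgroup_axioms)
  have com': "(A #> x) \<otimes>\<^bsub>G Mod A\<^esub> (A #> y) = (A #> y) \<otimes>\<^bsub>G Mod A\<^esub> (A #> x)"
    if "x \<in> carrier G" "y \<in> carrier G" for x y
  proof (rule images_commute_if_generators_commute[OF S _ that])
    fix s t assume st: "s \<in> S" "t \<in> S"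
    then have c: "s \<in> carrier G" "t \<in> carrier G" using S(2) by auto
    show "(A #> s) \<otimes>\<^bsub>G Mod A\<^esub> (A #> t) = (A #> t) \<otimes>\<^bsub>G Mod A\<^esub> (A #> s)"
      unfolding mult_FactGroup A.rcos_sum[OF c] A.rcos_sum[OF c(2,1)] by (rule eq[OF st])
  qed
  show "comm_group (G Mod A)"
  proof (rule Q.group_comm_groupI)
    fix a b assume "a \<in> carrier (G Mod A)" "b \<in> carrier (G Mod A)"
    then obtain x y where "x \<in> carrier G" "a = A #> x" "y \<in> carrier G" "b = A #> y"
      unfolding carrier_FactGroup by blast
    then show "a \<otimes>\<^bsub>G Mod A\<^esub> b = b \<otimes>\<^bsub>G Mod A\<^esub> a" using com' by metis
  qed
qed

section \<open>Construction of the twisted representation\<close>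

lemma group_hom_constant_term:
  "group_hom ring_units ring_units (\<lambda>g :: 'r::ring_1 fps. fps_nth g 0)"
proof (unfold group_hom_def group_hom_axioms_def, intro conjI group_ring_units homI)
  fix g :: "'r fps" assume "g \<in> carrier ring_units"
  then obtain h where "g * h = 1" "h * g = 1" by (auto simp: ring_units_carrier)
  from this[THEN arg_cong[where f = "\<lambda>g. fps_nth g 0"]]
  show "fps_nth g 0 \<in> carrier ring_units" by (auto simp: ring_units_carrier)
qed simp

text \<open>Vertices in \<open>T\<close> go to diagonal matrices conjugated by
  \<open>1 + fps_X * N\<close>, the others to constant diagonal matrices. Conjugation preserves
  orders, and images on the same side of \<open>T\<close> commute, so only edges crossing
  \<open>T\<close> need hypothesis \<open>T\<close>. The last two conclusions compute a first
  commutator across \<open>T\<close> and a further commutator with an untwisted generator.\<close>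

lemma twisted_representation:
  fixes V :: "'a set" and d1 d2 d3 :: "'a \<Rightarrow> complex" and N :: "complex mat3"
  defines "D \<equiv> \<lambda>v. diag3 (d1 v) (d2 v) (d3 v)"
  defines "D' \<equiv> \<lambda>v. diag3 (inverse (d1 v)) (inverse (d2 v)) (inverse (d3 v))"
  assumes nz: "\<forall>v. d1 v \<noteq> 0 \<and> d2 v \<noteq> 0 \<and> d3 v \<noteq> 0"
    and pow: "\<forall>v\<in>V. \<forall>n. f v = enat n \<longrightarrow> D v ^ n = 1"
    and T: "\<forall>v\<in>V \<inter> T. \<forall>w\<in>V - T. {v, w} \<in> E \<longrightarrow> D v = 1 \<or> D w = 1"
  shows "\<exists>\<phi> :: ('a \<times> bool) list set \<Rightarrow> complex mat3 fps.
    group_hom (graph_product V E f) ring_units \<phi> \<and>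
    (\<forall>g\<in>carrier (graph_product V E f). \<forall>h\<in>carrier (graph_product V E f).
      fps_nth (\<phi> g) 0 * fps_nth (\<phi> h) 0 = fps_nth (\<phi> h) 0 * fps_nth (\<phi> g) 0) \<and>
    (\<forall>v\<in>V - T. \<forall>w\<in>V \<inter> T.
      leading_term 1 (D v * (N - D w * N * D' w) * D' v - (N - D w * N * D' w))
        (\<phi> (group_commutator (graph_product V E f) (vertex_gen V E f v) (vertex_gen V E f w)))) \<and>
    (\<forall>v\<in>V - T. \<forall>h\<in>carrier (graph_product V E f). \<forall>A.
      leading_term 1 A (\<phi> h) \<longrightarrow> leading_term 1 (D v * A * D' v - A)
        (\<phi> (group_commutator (graph_product V E f) (vertex_gen V E f v) h)))"
proof -
  let ?c = fps_const
  define P where "P = 1 + fps_X * ?c N"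
  define P' where "P' = Abs_fps (\<lambda>n. (- N) ^ n)"
  have P: "P * P' = 1" "P' * P = 1"
    unfolding P_def P'_def by (rule geometric_inverse)+
  have lP: "leading_term 1 N P"
    unfolding leading_term_def P_def by (intro exI[of _ "?c N"]) simp
  have DD: "D v * D' v = 1" "D' v * D v = 1" for v
    using nz by (simp_all add: D_def D'_def diag3_mult diag3_one)
  have DC: "D v * D w = D w * D v" for v w
    by (simp add: D_def diag3_mult mult.commute)
  define \<gamma> where "\<gamma> v = (if v \<in> T then P * ?c (D v) * P' else ?c (D v))" for v
  define \<gamma>' where "\<gamma>' v = (if v \<in> T then P * ?c (D' v) * P' else ?c (D' v))" for v
  have PX: "P' * (P * u) = u" for u using P by (metis mult.assoc mult_1)
  have DX: "?c (D v) * (?c (D' v) * u) = u" "?c (D' v) * (?c (D v) * u) = u" for u v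
    using DD[of v] by (simp_all add: mult.assoc[symmetric])
  have \<gamma>\<gamma>': "\<gamma> v * \<gamma>' v = 1" "\<gamma>' v * \<gamma> v = 1" for v
    by (auto simp: \<gamma>_def \<gamma>'_def mult.assoc PX DX P DD)
  have \<gamma>_pow: "\<gamma> v ^ n = (if v \<in> T then P * ?c (D v ^ n) * P' else ?c (D v ^ n))" for v n
    by (induction n) (auto simp: \<gamma>_def mult.assoc PX P fps_const_mult[symmetric] simp del: fps_const_mult)
  have \<gamma>_com: "\<gamma> v * \<gamma> w = \<gamma> w * \<gamma> v" if "v \<in> V" "w \<in> V" "{v, w} \<in> E" for v w
  proof (cases "v \<in> T \<longleftrightarrow> w \<in> T")
    case True
    have "?c (D v) * (?c (D w) * u) = ?c (D w) * (?c (D v) * u)" for u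
      using DC[of v w] by (simp add: mult.assoc[symmetric])
    with True DC[of v w] show ?thesis
      by (auto simp: \<gamma>_def mult.assoc PX)
  next
    case False
    then have "D v = 1 \<or> D w = 1"
      using T[rule_format, of v w] T[rule_format, of w v] that by (auto simp: insert_commute)
    then show ?thesis by (auto simp: \<gamma>_def P)
  qed
  interpret U: group "ring_units :: complex mat3 fps monoid" by (rule group_ring_units)
  let ?G = "graph_product V E f" and ?g = "vertex_gen V E f"
  have car: "\<gamma> v \<in> carrier ring_units" for v using \<gamma>\<gamma>' by (auto simp: ring_units_carrier)
  have pw: "\<gamma> v [^]\<^bsub>ring_units\<^esub> n = \<one>\<^bsub>ring_units\<^esub>" if "v \<in> V" "f v = enat n" for v n
    using pow that by (simp add: \<gamma>_pow P)
  have cm: "\<gamma> v \<otimes>\<^bsub>ring_units\<^esub> \<gamma> w = \<gamma> w \<otimes>\<^bsub>ring_units\<^esub> \<gamma> v"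
    if "v \<in> V" "w \<in> V" "{v, w} \<in> E" for v w
    using \<gamma>_com[OF that] by simp
  obtain \<phi> where hom: "group_hom ?G ring_units \<phi>"
    and \<phi>: "\<And>v. v \<in> V \<Longrightarrow> \<phi> (?g v) = \<gamma> v"
    using U.graph_product_hom[of V \<gamma> f E, OF car pw cm] by blast
  interpret group_hom ?G ring_units \<phi> by (rule hom)
  interpret C: group_hom "ring_units :: complex mat3 fps monoid" ring_units "\<lambda>g. fps_nth g 0"
    by (rule group_hom_constant_term)
  interpret C\<phi>: group_hom ?G ring_units "(\<lambda>g. fps_nth g 0) \<circ> \<phi>"
    unfolding group_hom_def group_hom_axioms_def
    using G.is_group C.H.is_group Group.hom_compose[OF homh C.homh] by blast
  have P0: "fps_nth P 0 = 1" "fps_nth P' 0 = 1" by (simp_all add: P_def P'_def)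
  \<comment> \<open>\<open>P\<close> has constant term 1, so reduction modulo the variable forgets
    the twist and leaves commuting diagonal matrices.\<close>
  have "fps_nth (\<gamma> v) 0 = D v" for v by (simp add: \<gamma>_def P0)
  then have c: "fps_nth (\<phi> g) 0 * fps_nth (\<phi> h) 0 = fps_nth (\<phi> h) 0 * fps_nth (\<phi> g) 0"
    if "g \<in> carrier ?G" "h \<in> carrier ?G" for g h
    using C\<phi>.images_commute_if_generators_commute[OF generate_vertex_gens _ _ that] \<phi> DC
    by (force simp: vertex_gen_closed)
  have inv: "inv\<^bsub>ring_units\<^esub> (\<gamma> v) = \<gamma>' v" for v
    by (rule ring_units_inv_equality) (rule \<gamma>\<gamma>')+
  have l1: "leading_term 1 (D v * (N - D w * N * D' w) * D' v - (N - D w * N * D' w))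
        (\<phi> (group_commutator ?G (?g v) (?g w)))"
    if "v \<in> V - T" "w \<in> V \<inter> T" for v w
  proof -
    have "\<phi> (group_commutator ?G (?g v) (?g w)) = \<gamma> v * \<gamma> w * \<gamma>' v * \<gamma>' w"
      using that vertex_gen_closed[of _ V E f] by (simp add: group_commutator_def \<phi> inv)
    with leading_term_twisted_commutator[OF P lP DD DD DC, of v w] that show ?thesis
      by (simp add: \<gamma>_def \<gamma>'_def)
  qed
  \<comment> \<open>The commutator is a conjugate of \<open>\<phi> h\<close> times the inverse of
    \<open>\<phi> h\<close>, so the coefficients \<open>D v * A * D' v\<close> and
    \<open>- A\<close> add up.\<close>
  have l2: "leading_term 1 (D v * A * D' v - A) (\<phi> (group_commutator ?G (?g v) h))"
    if v: "v \<in> V - T" and h: "h \<in> carrier ?G" and A: "leading_term 1 A (\<phi> h)" for v h A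
  proof -
    have "\<phi> h * inv\<^bsub>ring_units\<^esub> (\<phi> h) = 1" using h by (simp add: ring_units_inv)
    then have "leading_term 1 (- A) (inv\<^bsub>ring_units\<^esub> (\<phi> h))"
      using leading_term_inverse[OF A] by simp
    moreover have "leading_term 1 (D v * A * D' v) (\<gamma> v * \<phi> h * \<gamma>' v)"
      using leading_term_conj[OF A \<gamma>\<gamma>'(1)[of v]] v by (simp add: \<gamma>_def \<gamma>'_def)
    ultimately have "leading_term 1 (D v * A * D' v + - A)
        (\<gamma> v * \<phi> h * \<gamma>' v * inv\<^bsub>ring_units\<^esub> (\<phi> h))"
      by (intro leading_term_mult) auto
    then show ?thesis
      using v h vertex_gen_closed[of v V E f] by (simp add: group_commutator_def \<phi> inv)
  qed
  show ?thesis
    by (intro exI[of _ \<phi>] conjI ballI allI impI) (rule hom, erule (1) c, erule (1) l1, erule (2) l2)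
qed

section \<open>Two obstructions that force infinite derived length\<close>

text \<open>For an infinite label the number 2 serves, for label 2 the number -1. The last clause
  makes \<zeta> differ from its inverse whenever the label is not 2.\<close>

lemma root_of_unity_exists:
  assumes "(n :: enat) \<ge> 2"
  shows "\<exists>\<zeta> :: complex. \<zeta> \<noteq> 0 \<and> \<zeta> \<noteq> 1 \<and> (\<forall>k. n = enat k \<longrightarrow> \<zeta> ^ k = 1) \<and>
    (n \<noteq> 2 \<longrightarrow> \<zeta> ^ 2 \<noteq> 1)"
proof (cases n)
  case infinity
  show ?thesis by (rule exI[of _ 2]) (simp add: infinity)
next
  case (enat k)
  then have k: "k \<ge> 2" using assms by (simp add: numeral_eq_enat)
  show ?thesis
  proof (cases "k = 2")
    case True
    then show ?thesis by (intro exI[of _ "-1"]) (simp add: enat numeral_eq_enat)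
  next
    case False
    \<comment> \<open>Counting: there are \<open>k > 2\<close> roots of unity of order dividing
      \<open>k\<close>, but two square roots of 1.\<close>
    have "\<not> {z :: complex. z ^ k = 1} \<subseteq> {z. z ^ 2 = 1}"
    proof
      assume sub: "{z :: complex. z ^ k = 1} \<subseteq> {z. z ^ 2 = 1}"
      have "finite {z :: complex. z ^ 2 = 1}"
        by (rule card_ge_0_finite) (simp add: card_roots_unity_eq)
      from card_mono[OF this sub] show False
        using k False by (simp add: card_roots_unity_eq)
    qed
    then obtain \<zeta> :: complex where "\<zeta> ^ k = 1" "\<zeta> ^ 2 \<noteq> 1" by auto
    then show ?thesis
      using k by (intro exI[of _ \<zeta>]) (auto simp: enat power_0_left)
  qed
qed

text \<open>Take \<open>g\<close> as the commutator of the two generators and \<open>h\<close> as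
  that of \<open>v\<close> with \<open>g\<close>. Conjugation by the image of \<open>v\<close>
  scales the off-diagonal entries by \<zeta> and its inverse, so the two leading coefficients are
  independent once these differ. The condition \<open>a \<noteq> 0\<close> alone serves to show that
  the derived subgroup is nontrivial.\<close>

lemma nonadjacent_pair_representation:
  assumes v: "v \<in> V" and w: "w \<in> V" and "v \<noteq> w" "{v, w} \<notin> E" "f v \<ge> 2" "f w \<ge> 2"
  defines "G \<equiv> graph_product V E f"
  shows "\<exists>(\<phi> :: ('a \<times> bool) list set \<Rightarrow> complex mat3 fps) a b c d. \<exists>g\<in>derived G (carrier G).
    \<exists>h\<in>derived G (carrier G). group_hom G ring_units \<phi> \<and>
    (\<forall>g\<in>carrier G. \<forall>h\<in>carrier G. fps_nth (\<phi> g) 0 * fps_nth (\<phi> h) 0 = fps_nth (\<phi> h) 0 * fps_nth (\<phi> g) 0) \<and>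
    leading_term 1 (sl2_plane a b) (\<phi> g) \<and> leading_term 1 (sl2_plane c d) (\<phi> h) \<and>
    a \<noteq> 0 \<and> (f v \<noteq> 2 \<longrightarrow> a * d \<noteq> b * c)"
proof -
  obtain \<zeta> :: complex where \<zeta>: "\<zeta> \<noteq> 0" "\<zeta> \<noteq> 1" "\<forall>k. f v = enat k \<longrightarrow> \<zeta> ^ k = 1" "f v \<noteq> 2 \<longrightarrow> \<zeta> ^ 2 \<noteq> 1"
    using root_of_unity_exists[OF assms(5)] by blast
  obtain \<xi> :: complex where \<xi>: "\<xi> \<noteq> 0" "\<xi> \<noteq> 1" "\<forall>k. f w = enat k \<longrightarrow> \<xi> ^ k = 1"
    using root_of_unity_exists[OF assms(6)] by blast
  \<comment> \<open>All vertices other than \<open>v\<close> and \<open>w\<close> are sent to the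
    identity; \<open>w\<close> is the only twisted one.\<close>
  define \<delta> where "\<delta> u = (if u = v then \<zeta> else if u = w then \<xi> else 1)" for u
  let ?D = "\<lambda>v. diag3 (\<delta> v) 1 1" and ?D' = "\<lambda>v. diag3 (inverse (\<delta> v)) (inverse 1) (inverse 1)"
  let ?N = "sl2_plane 1 1 :: complex mat3"
  have nz: "\<forall>u. \<delta> u \<noteq> 0 \<and> (1::complex) \<noteq> 0 \<and> (1::complex) \<noteq> 0"
    using \<zeta> \<xi> by (simp add: \<delta>_def)
  have pow: "\<forall>u\<in>V. \<forall>n. f u = enat n \<longrightarrow> ?D u ^ n = 1"
    using \<zeta>(3) \<xi>(3) by (auto simp: \<delta>_def diag3_power diag3_one)
  have T: "\<forall>u\<in>V \<inter> {w}. \<forall>u'\<in>V - {w}. {u, u'} \<in> E \<longrightarrow> ?D u = 1 \<or> ?D u' = 1"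
    using assms(4) by (auto simp: \<delta>_def diag3_one insert_commute)
  obtain \<phi> :: "('a \<times> bool) list set \<Rightarrow> complex mat3 fps" where
    hom: "group_hom G ring_units \<phi>" and
    com: "\<forall>g\<in>carrier G. \<forall>h\<in>carrier G.
      fps_nth (\<phi> g) 0 * fps_nth (\<phi> h) 0 = fps_nth (\<phi> h) 0 * fps_nth (\<phi> g) 0" and
    l1: "\<forall>v\<in>V - {w}. \<forall>w\<in>V \<inter> {w}.
      leading_term 1 (?D v * (?N - ?D w * ?N * ?D' w) * ?D' v - (?N - ?D w * ?N * ?D' w))
        (\<phi> (group_commutator G (vertex_gen V E f v) (vertex_gen V E f w)))" and
    l2: "\<forall>v\<in>V - {w}. \<forall>h\<in>carrier G. \<forall>A.
      leading_term 1 A (\<phi> h) \<longrightarrow> leading_term 1 (?D v * A * ?D' v - A)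
        (\<phi> (group_commutator G (vertex_gen V E f v) h))"
    using twisted_representation[of \<delta> "\<lambda>_. 1" "\<lambda>_. 1" V f "{w}" E ?N, OF nz pow T]
    unfolding G_def[symmetric] by (elim exE conjE) (rule that)
  interpret group_hom G ring_units \<phi> by (rule hom)
  let ?v = "vertex_gen V E f v" and ?w = "vertex_gen V E f w"
  have vw: "?v \<in> carrier G" "?w \<in> carrier G"
    using v w by (simp_all add: G_def vertex_gen_closed)
  define g where "g = group_commutator G ?v ?w"
  define h where "h = group_commutator G ?v g"
  have g: "g \<in> carrier G" using vw by (simp add: g_def G.group_commutator_closed)
  have der: "g \<in> derived G (carrier G)" "h \<in> derived G (carrier G)"
    using vw g by (simp_all add: g_def h_def group_commutator_in_derived)
  \<comment> \<open>Conjugation by \<open>?D w\<close> turns the entries 1, 1 of \<open>?N\<close>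
    into \<xi> and its inverse, and \<open>?D v\<close> scales by \<zeta> and its inverse;
    \<open>a\<close> and \<open>b\<close> collect the differences.\<close>
  define a where "a = (\<zeta> - 1) * (1 - \<xi>)"
  define b where "b = (inverse \<zeta> - 1) * (1 - inverse \<xi>)"
  have "?D v * (?N - ?D w * ?N * ?D' w) * ?D' v - (?N - ?D w * ?N * ?D' w) = sl2_plane a b"
    using \<open>v \<noteq> w\<close> by (simp add: \<delta>_def diag3_def sl2_plane_def a_def b_def algebra_simps)
  moreover have "v \<in> V - {w}" "w \<in> V \<inter> {w}" using v w \<open>v \<noteq> w\<close> by auto
  ultimately have lg: "leading_term 1 (sl2_plane a b) (\<phi> g)"
    using l1 unfolding g_def by metis
  moreover have "?D v * sl2_plane a b * ?D' v - sl2_plane a b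
      = sl2_plane ((\<zeta> - 1) * a) ((inverse \<zeta> - 1) * b)"
    by (simp add: \<delta>_def diag3_def sl2_plane_def algebra_simps)
  ultimately have lh: "leading_term 1 (sl2_plane ((\<zeta> - 1) * a) ((inverse \<zeta> - 1) * b)) (\<phi> h)"
    using l2 g \<open>v \<in> V - {w}\<close> unfolding h_def by metis
  have ab: "a \<noteq> 0" "b \<noteq> 0" using \<zeta> \<xi> by (simp_all add: a_def b_def)
  have "a * ((inverse \<zeta> - 1) * b) \<noteq> b * ((\<zeta> - 1) * a)" if "f v \<noteq> 2"
  proof
    assume "a * ((inverse \<zeta> - 1) * b) = b * ((\<zeta> - 1) * a)"
    then have "inverse \<zeta> = \<zeta>" using ab by simp
    then show False using \<zeta>(1) \<zeta>(4) that by (metis power2_eq_square right_inverse)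
  qed
  with hom com der lg lh ab(1) show ?thesis by blast
qed

lemma derived_graph_product_nontrivial:
  assumes "v \<in> V" "w \<in> V" "v \<noteq> w" "{v, w} \<notin> E" "f v \<ge> 2" "f w \<ge> 2"
  shows "derived (graph_product V E f) (carrier (graph_product V E f)) \<noteq> {\<one>\<^bsub>graph_product V E f\<^esub>}"
proof
  assume triv: "derived (graph_product V E f) (carrier (graph_product V E f)) = {\<one>\<^bsub>graph_product V E f\<^esub>}"
  obtain \<phi> :: "('a \<times> bool) list set \<Rightarrow> complex mat3 fps" and a b g where
    hom: "group_hom (graph_product V E f) ring_units \<phi>" and
    g: "g \<in> derived (graph_product V E f) (carrier (graph_product V E f))"
      "leading_term 1 (sl2_plane a b) (\<phi> g)" "a \<noteq> 0"
    using nonadjacent_pair_representation[OF assms] by blast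
  interpret group_hom "graph_product V E f" ring_units \<phi> by (rule hom)
  have "\<phi> g = 1" using g(1) triv hom_one by simp
  with g(2) have "sl2_plane a b = 0" using leading_term_eq_zero by metis
  with g(3) show False by (simp add: sl2_plane_def zero_mat3_def)
qed

lemma derived_length_infinite_of_label:
  assumes "v \<in> V" "w \<in> V" "v \<noteq> w" "{v, w} \<notin> E" "f v \<ge> 2" "f w \<ge> 2" and "f v \<noteq> 2"
  shows "derived_length (graph_product V E f) = \<infinity>"
proof -
  let ?G = "graph_product V E f"
  interpret group ?G by (rule group_graph_product)
  obtain \<phi> :: "('a \<times> bool) list set \<Rightarrow> complex mat3 fps" and a b c d g h where
    hom: "group_hom ?G ring_units \<phi>" and
    com: "\<forall>g\<in>carrier ?G. \<forall>h\<in>carrier ?G.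
      fps_nth (\<phi> g) 0 * fps_nth (\<phi> h) 0 = fps_nth (\<phi> h) 0 * fps_nth (\<phi> g) 0" and
    gh: "g \<in> derived ?G (carrier ?G)" "h \<in> derived ?G (carrier ?G)" and
    l: "leading_term 1 (sl2_plane a b) (\<phi> g)" "leading_term 1 (sl2_plane c d) (\<phi> h)" and
    ad: "f v \<noteq> 2 \<longrightarrow> a * d \<noteq> b * c"
    using nonadjacent_pair_representation[OF assms(1-6)] by blast
  have "g \<in> carrier ?G" "h \<in> carrier ?G"
    using gh derived_in_carrier[of "carrier ?G"] by auto
  moreover have sp: "spans_plane sl2_plane (sl2_plane a b) (sl2_plane c d)"
    using ad assms(7) by (auto simp: spans_plane_def)
  ultimately show ?thesis
    using spans_plane_bracket spans_plane_nonzero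
    by (intro derived_length_infinite[where P = "spans_plane sl2_plane", OF hom com[rule_format] _ _ sp _ l])
      auto
qed

text \<open>With all labels 2 the scalars are -1 and equal their inverses, so the
  \<open>sl2_plane\<close> pair degenerates. Instead \<open>y\<close>, \<open>z\<close>,
  \<open>x\<close> act as reflections in the three coordinates, and commuting \<open>x\<close> with
  each of \<open>y\<close> and \<open>z\<close> gives two independent directions in
  \<open>so3_plane\<close>.\<close>

lemma derived_length_infinite_of_two_nonneighbours:
  assumes x: "x \<in> V" and y: "y \<in> V" and z: "z \<in> V"
    and dist: "x \<noteq> y" "x \<noteq> z" "y \<noteq> z" and nonadj: "{x, y} \<notin> E" "{x, z} \<notin> E"
    and f: "f x = 2" "f y = 2" "f z = 2"
  shows "derived_length (graph_product V E f) = \<infinity>"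
proof -
  let ?G = "graph_product V E f"
  define d1 where "d1 u = (if u = y then - 1 else 1 :: complex)" for u
  define d2 where "d2 u = (if u = z then - 1 else 1 :: complex)" for u
  define d3 where "d3 u = (if u = x then - 1 else 1 :: complex)" for u
  let ?D = "\<lambda>v. diag3 (d1 v) (d2 v) (d3 v)"
    and ?D' = "\<lambda>v. diag3 (inverse (d1 v)) (inverse (d2 v)) (inverse (d3 v))"
  let ?N = "so3_plane 1 1 :: complex mat3"
  have nz: "\<forall>u. d1 u \<noteq> 0 \<and> d2 u \<noteq> 0 \<and> d3 u \<noteq> 0" by (simp add: d1_def d2_def d3_def)
  have "?D u ^ n = 1" if "f u = enat n" for u n
  proof (cases "u \<in> {x, y, z}")
    case True
    then have "n = 2" using that f by (auto simp: numeral_eq_enat)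
    then show ?thesis by (simp add: d1_def d2_def d3_def diag3_power diag3_one)
  qed (auto simp: d1_def d2_def d3_def diag3_one)
  then have pow: "\<forall>u\<in>V. \<forall>n. f u = enat n \<longrightarrow> ?D u ^ n = 1" by blast
  have T: "\<forall>u\<in>V \<inter> {x}. \<forall>u'\<in>V - {x}. {u, u'} \<in> E \<longrightarrow> ?D u = 1 \<or> ?D u' = 1"
    using nonadj by (auto simp: d1_def d2_def d3_def diag3_one)
  obtain \<phi> :: "('a \<times> bool) list set \<Rightarrow> complex mat3 fps" where
    hom: "group_hom ?G ring_units \<phi>" and
    com: "\<forall>g\<in>carrier ?G. \<forall>h\<in>carrier ?G.
      fps_nth (\<phi> g) 0 * fps_nth (\<phi> h) 0 = fps_nth (\<phi> h) 0 * fps_nth (\<phi> g) 0" and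
    l: "\<forall>v\<in>V - {x}. \<forall>w\<in>V \<inter> {x}.
      leading_term 1 (?D v * (?N - ?D w * ?N * ?D' w) * ?D' v - (?N - ?D w * ?N * ?D' w))
        (\<phi> (group_commutator ?G (vertex_gen V E f v) (vertex_gen V E f w)))"
    using twisted_representation[of d1 d2 d3 V f "{x}" E ?N, OF nz pow T]
    by (elim exE conjE) (rule that)
  interpret group_hom ?G ring_units \<phi> by (rule hom)
  let ?g = "vertex_gen V E f"
  \<comment> \<open>Conjugation by \<open>?D x\<close> negates \<open>?N\<close>, so the twist
    contributes \<open>2 * ?N\<close>; \<open>?D y\<close> and \<open>?D z\<close> then each negate
    one coordinate of the plane.\<close>
  have "?D y * (?N - ?D x * ?N * ?D' x) * ?D' y - (?N - ?D x * ?N * ?D' x) = so3_plane (- 4) 0"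
    and "?D z * (?N - ?D x * ?N * ?D' x) * ?D' z - (?N - ?D x * ?N * ?D' x) = so3_plane 0 (- 4)"
    using dist by (simp_all add: d1_def d2_def d3_def diag3_def so3_plane_def)
  moreover have "y \<in> V - {x}" "z \<in> V - {x}" "x \<in> V \<inter> {x}" using x y z dist by auto
  ultimately have lt: "leading_term 1 (so3_plane (- 4) 0) (\<phi> (group_commutator ?G (?g y) (?g x)))"
    "leading_term 1 (so3_plane 0 (- 4)) (\<phi> (group_commutator ?G (?g z) (?g x)))"
    using l by metis+
  have sp: "spans_plane so3_plane (so3_plane (- 4) 0) (so3_plane 0 (- 4))"
    unfolding spans_plane_def
    by (rule exI[of _ "- 4"], rule exI[of _ 0], rule exI[of _ 0], rule exI[of _ "- 4"]) simp
  have "group_commutator ?G (?g u) (?g x) \<in> carrier ?G" if "u \<in> V" for u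
    using that x by (simp add: vertex_gen_closed G.group_commutator_closed)
  then show ?thesis
    using y z spans_plane_bracket spans_plane_nonzero
    by (intro derived_length_infinite[where P = "spans_plane so3_plane", OF hom com[rule_format] _ _ sp _ lt])
      auto
qed

section \<open>Small derived length\<close>

lemma (in group) derived_trivial_iff_commute:
  assumes "H \<subseteq> carrier G"
  shows "derived G H = {\<one>} \<longleftrightarrow> (\<forall>x\<in>H. \<forall>y\<in>H. x \<otimes> y = y \<otimes> x)"
proof
  assume triv: "derived G H = {\<one>}"
  show "\<forall>x\<in>H. \<forall>y\<in>H. x \<otimes> y = y \<otimes> x"
  proof (intro ballI)
    fix x y assume xy: "x \<in> H" "y \<in> H"
    then have "group_commutator G x y = \<one>" using group_commutator_in_derived[OF xy, of G] triv by simp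
    then have "(x \<otimes> y) \<otimes> inv (y \<otimes> x) = \<one>"
      using xy assms by (simp add: group_commutator_def inv_mult_group m_assoc subset_iff)
    then show "x \<otimes> y = y \<otimes> x"
      using xy assms by (metis inv_closed inv_equality inv_inv m_closed subsetD)
  qed
next
  assume com: "\<forall>x\<in>H. \<forall>y\<in>H. x \<otimes> y = y \<otimes> x"
  have "x \<otimes> y \<otimes> inv x \<otimes> inv y = \<one>" if "x \<in> H" "y \<in> H" for x y
  proof -
    have xy: "x \<in> carrier G" "y \<in> carrier G" using that assms by auto
    have "x \<otimes> y \<otimes> inv x \<otimes> inv y = (x \<otimes> y) \<otimes> inv (y \<otimes> x)"
      using xy by (simp add: inv_mult_group m_assoc)
    also have "\<dots> = \<one>" using com that xy by simp
    finally show ?thesis .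
  qed
  then have "derived G H \<subseteq> {\<one>}"
    unfolding derived_def by (intro generate_subgroup_incl triv_subgroup) auto
  then show "derived G H = {\<one>}" using generate.one unfolding derived_def by blast
qed

lemma (in group) derived_trivial: "derived G {\<one>} = {\<one>}"
  by (simp add: derived_trivial_iff_commute)

lemma derived_length_eqI:
  assumes "derived_series G n = derived_series G (Suc n)"
    and "\<And>m. m < n \<Longrightarrow> derived_series G m \<noteq> derived_series G (Suc m)"
  shows "derived_length G = enat n"
proof -
  have "(LEAST i. derived_series G i = derived_series G (Suc i)) = n"
    using assms by (intro Least_equality) (auto simp: not_less[symmetric])
  then show ?thesis using assms(1) by (auto simp: derived_length_def)
qed

lemma (in group) derived_length_one:
  assumes "derived G (carrier G) = {\<one>}" and "carrier G \<noteq> {\<one>}"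
  shows "derived_length G = 1"
  unfolding one_enat_def
  by (rule derived_length_eqI) (use assms in \<open>auto simp: derived_series_def derived_trivial\<close>)

text \<open>Index 0 is not stationary either: if the group equalled its derived subgroup, the second
  derived subgroup would equal the first and be nontrivial.\<close>

lemma (in group) derived_length_two:
  assumes "derived G (derived G (carrier G)) = {\<one>}" and "derived G (carrier G) \<noteq> {\<one>}"
  shows "derived_length G = 2"
proof -
  have "derived_length G = enat 2"
  proof (rule derived_length_eqI)
    fix m :: nat assume "m < 2"
    then consider "m = 0" | "m = 1" by linarith
    then show "derived_series G m \<noteq> derived_series G (Suc m)"
      using assms by cases (auto simp: derived_series_def)
  qed (use assms in \<open>simp add: derived_series_def derived_trivial numeral_2_eq_2\<close>)
  then show ?thesis by (simp add: numeral_eq_enat)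
qed

section \<open>Abelian and metabelian graph products\<close>

text \<open>The generator of \<open>v\<close> is detected by the character that sends it to \<zeta>
  and every other vertex to 1.\<close>

lemma graph_product_nontrivial:
  assumes "v \<in> V" and "f v \<ge> 2"
  shows "carrier (graph_product V E f) \<noteq> {\<one>\<^bsub>graph_product V E f\<^esub>}"
proof
  assume triv: "carrier (graph_product V E f) = {\<one>\<^bsub>graph_product V E f\<^esub>}"
  obtain \<zeta> :: complex where \<zeta>: "\<zeta> \<noteq> 0" "\<zeta> \<noteq> 1" "\<forall>k. f v = enat k \<longrightarrow> \<zeta> ^ k = 1"
    using root_of_unity_exists[OF assms(2)] by blast
  interpret U: group "ring_units :: complex monoid" by (rule group_ring_units)
  have "(if u = v then \<zeta> else 1) \<in> carrier ring_units" for u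
    using \<zeta>(1) by (auto simp: ring_units_carrier intro: exI[of _ "inverse \<zeta>"])
  moreover have "(if u = v then \<zeta> else 1) ^ n = 1" if "f u = enat n" for u n
    using that \<zeta>(3) by auto
  ultimately obtain \<phi> :: "_ \<Rightarrow> complex" where hom: "group_hom (graph_product V E f) ring_units \<phi>"
    and \<phi>: "\<forall>u\<in>V. \<phi> (vertex_gen V E f u) = (if u = v then \<zeta> else 1)"
    using U.graph_product_hom[of V "\<lambda>u. if u = v then \<zeta> else 1" f E]
    unfolding ring_units_pow ring_units_one ring_units_mult by (auto simp: mult.commute)
  interpret group_hom "graph_product V E f" ring_units \<phi> by (rule hom)
  have "vertex_gen V E f v = \<one>\<^bsub>graph_product V E f\<^esub>"
    using triv vertex_gen_closed[OF assms(1)] by blast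
  then have "\<zeta> = 1" using \<phi> assms(1) hom_one by fastforce
  then show False using \<zeta>(2) by simp
qed

lemma derived_complete_graph_product:
  assumes "\<forall>v\<in>V. \<forall>w\<in>V. v \<noteq> w \<longrightarrow> {v, w} \<in> E"
  shows "derived (graph_product V E f) (carrier (graph_product V E f)) = {\<one>\<^bsub>graph_product V E f\<^esub>}"
proof -
  let ?G = "graph_product V E f" and ?g = "vertex_gen V E f"
  interpret group ?G by (rule group_graph_product)
  have S: "?g ` V \<subseteq> carrier ?G" by (auto simp: vertex_gen_closed)
  have "?g v \<otimes>\<^bsub>?G\<^esub> ?g w = ?g w \<otimes>\<^bsub>?G\<^esub> ?g v" if "v \<in> V" "w \<in> V" for v w
    using that assms vertex_gen_commute[of v V w E f] by (cases "v = w") auto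
  then have "x \<otimes>\<^bsub>?G\<^esub> y = y \<otimes>\<^bsub>?G\<^esub> x" if "x \<in> ?g ` V" "y \<in> ?g ` V" for x y
    using that by blast
  from generate_commute[OF S this] show ?thesis
    by (subst derived_trivial_iff_commute) (simp_all add: generate_vertex_gens)
qed

text \<open>Each independent pair generates a dihedral piece in which
  \<open>?g v \<otimes> ?g w\<close> acts as a translation, inverted by both reflections. The set
  \<open>S\<close> of all such products is commuting and closed under conjugation, so it generates
  an abelian normal subgroup, and modulo it all generators commute.\<close>

lemma second_derived_trivial_of_matching:
  assumes lab: "\<forall>v\<in>V. \<forall>w\<in>V. v \<noteq> w \<longrightarrow> {v, w} \<notin> E \<longrightarrow> f v = 2"
    and uniq: "\<forall>x\<in>V. \<forall>y\<in>V. \<forall>z\<in>V. x \<noteq> y \<longrightarrow> x \<noteq> z \<longrightarrow> {x, y} \<notin> E \<longrightarrow> {x, z} \<notin> E \<longrightarrow> y = z"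
  defines "G \<equiv> graph_product V E f"
  shows "derived G (derived G (carrier G)) = {\<one>\<^bsub>G\<^esub>}"
proof -
  interpret group G unfolding G_def by (rule group_graph_product)
  let ?g = "vertex_gen V E f"
  define N where "N v w \<longleftrightarrow> v \<in> V \<and> w \<in> V \<and> v \<noteq> w \<and> {v, w} \<notin> E" for v w
  have N_sym: "N w v" if "N v w" for v w using that by (auto simp: N_def insert_commute)
  have N_uniq: "w = w'" if "N v w" "N v w'" for v w w' using that uniq by (simp add: N_def) metis
  define S where "S = {?g v \<otimes>\<^bsub>G\<^esub> ?g w | v w. N v w}"
  have g: "?g v \<in> carrier G" if "v \<in> V" for v using that by (simp add: G_def vertex_gen_closed)
  have gN: "?g v \<in> carrier G" "?g w \<in> carrier G" if "N v w" for v w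
    using that g by (auto simp: N_def)
  have sq: "?g v \<otimes>\<^bsub>G\<^esub> ?g v = \<one>\<^bsub>G\<^esub>" if "N v w" for v w
  proof -
    have "v \<in> V" "f v = enat 2" using that lab by (auto simp: N_def numeral_eq_enat)
    then have "?g v [^]\<^bsub>G\<^esub> (2::nat) = \<one>\<^bsub>G\<^esub>" unfolding G_def by (rule vertex_gen_pow)
    then show ?thesis using gN[OF that] by (simp add: numeral_2_eq_2)
  qed
  have com: "?g v \<otimes>\<^bsub>G\<^esub> ?g w = ?g w \<otimes>\<^bsub>G\<^esub> ?g v" if "v \<in> V" "w \<in> V" "\<not> N v w" for v w
    using that vertex_gen_commute[of v V w E f] by (cases "v = w") (auto simp: N_def G_def)
  have inv_g: "inv\<^bsub>G\<^esub> (?g v) = ?g v" if "N v w" for v w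
    using sq[OF that] gN[OF that] by (intro inv_equality) auto
  have S: "S \<subseteq> carrier G" using gN by (auto simp: S_def)
  have flip: "?g v \<otimes>\<^bsub>G\<^esub> ?g w \<otimes>\<^bsub>G\<^esub> (?g w \<otimes>\<^bsub>G\<^esub> ?g v) = \<one>\<^bsub>G\<^esub>" if "N v w" for v w
  proof -
    have "?g v \<otimes>\<^bsub>G\<^esub> ?g w \<otimes>\<^bsub>G\<^esub> (?g w \<otimes>\<^bsub>G\<^esub> ?g v) = ?g v \<otimes>\<^bsub>G\<^esub> (?g w \<otimes>\<^bsub>G\<^esub> ?g w) \<otimes>\<^bsub>G\<^esub> ?g v"
      using gN[OF that] by (simp add: m_assoc)
    then show ?thesis using sq[OF that] sq[OF N_sym[OF that]] gN[OF that] by simp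
  qed
  have com_S: "s \<otimes>\<^bsub>G\<^esub> ?g u = ?g u \<otimes>\<^bsub>G\<^esub> s"
    if s: "s = ?g v \<otimes>\<^bsub>G\<^esub> ?g w" and N: "N v w" and u: "u \<in> V" "u \<noteq> v" "u \<noteq> w" for s u v w
  proof -
    have "\<not> N v u" "\<not> N w u" using N_uniq[OF N] N_uniq[OF N_sym[OF N]] u by auto
    then have "?g v \<otimes>\<^bsub>G\<^esub> ?g u = ?g u \<otimes>\<^bsub>G\<^esub> ?g v" "?g w \<otimes>\<^bsub>G\<^esub> ?g u = ?g u \<otimes>\<^bsub>G\<^esub> ?g w"
      using com N u by (auto simp: N_def)
    then show ?thesis using gN[OF N] g[OF u(1)] unfolding s by (metis m_assoc)
  qed
  have com_SS: "s \<otimes>\<^bsub>G\<^esub> t = t \<otimes>\<^bsub>G\<^esub> s" if "s \<in> S" "t \<in> S" for s t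
  proof -
    from that obtain v w x y where s: "s = ?g v \<otimes>\<^bsub>G\<^esub> ?g w" "N v w" and t: "t = ?g x \<otimes>\<^bsub>G\<^esub> ?g y" "N x y"
      by (auto simp: S_def)
    have c: "s \<in> carrier G" "t \<in> carrier G" using that S by auto
    consider "x = v" | "x = w" | "x \<noteq> v" "x \<noteq> w" by blast
    \<comment> \<open>Since independent pairs form a matching, two of them are equal, reversed or
      disjoint. Reversed pairs give mutually inverse products.\<close>
    then show ?thesis
    proof cases
      case 1
      then have "y = w" using N_uniq s t by blast
      with 1 s t show ?thesis by simp
    next
      case 2
      then have "y = v" using N_uniq N_sym s t by blast
      with 2 s t flip[OF s(2)] flip[OF t(2)] show ?thesis by simp
    next
      case 3
      then have "y \<noteq> v" "y \<noteq> w" using N_uniq N_sym s t by blast+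
      with 3 have "s \<otimes>\<^bsub>G\<^esub> ?g x = ?g x \<otimes>\<^bsub>G\<^esub> s" "s \<otimes>\<^bsub>G\<^esub> ?g y = ?g y \<otimes>\<^bsub>G\<^esub> s"
        using com_S[OF s] t(2) by (auto simp: N_def)
      then show ?thesis using c gN[OF t(2)] unfolding t(1) by (metis m_assoc)
    qed
  qed
  \<comment> \<open>Both directions are recorded because words in the generators also contain
    inverses.\<close>
  have conj_gen: "?g u \<otimes>\<^bsub>G\<^esub> s \<otimes>\<^bsub>G\<^esub> inv\<^bsub>G\<^esub> (?g u) \<in> S \<and> inv\<^bsub>G\<^esub> (?g u) \<otimes>\<^bsub>G\<^esub> s \<otimes>\<^bsub>G\<^esub> ?g u \<in> S"
    if u: "u \<in> V" and sS: "s \<in> S" for u s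
  proof -
    from sS obtain v w where s: "s = ?g v \<otimes>\<^bsub>G\<^esub> ?g w" "N v w" by (auto simp: S_def)
    note vw = gN[OF s(2)]
    have sc: "s \<in> carrier G" using sS S by auto
    have rev: "?g w \<otimes>\<^bsub>G\<^esub> ?g v \<in> S" using N_sym[OF s(2)] by (auto simp: S_def)
    consider "u = v" | "u = w" | "u \<noteq> v" "u \<noteq> w" by blast
    then show ?thesis
    proof cases
      case 1
      have "?g v \<otimes>\<^bsub>G\<^esub> s \<otimes>\<^bsub>G\<^esub> ?g v = (?g v \<otimes>\<^bsub>G\<^esub> ?g v) \<otimes>\<^bsub>G\<^esub> (?g w \<otimes>\<^bsub>G\<^esub> ?g v)"
        using vw unfolding s(1) by (simp add: m_assoc)
      then show ?thesis using 1 rev sq[OF s(2)] vw inv_g[OF s(2)] by simp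
    next
      case 2
      have "?g w \<otimes>\<^bsub>G\<^esub> s \<otimes>\<^bsub>G\<^esub> ?g w = (?g w \<otimes>\<^bsub>G\<^esub> ?g v) \<otimes>\<^bsub>G\<^esub> (?g w \<otimes>\<^bsub>G\<^esub> ?g w)"
        using vw unfolding s(1) by (simp add: m_assoc)
      then show ?thesis using 2 rev sq[OF N_sym[OF s(2)]] vw inv_g[OF N_sym[OF s(2)]] by simp
    next
      case 3
      have c: "s \<otimes>\<^bsub>G\<^esub> ?g u = ?g u \<otimes>\<^bsub>G\<^esub> s" using com_S[OF s u] 3 by simp
      have "?g u \<otimes>\<^bsub>G\<^esub> s \<otimes>\<^bsub>G\<^esub> inv\<^bsub>G\<^esub> (?g u) = s"
        using g[OF u] sc c[symmetric] by (simp add: m_assoc)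
      moreover have "inv\<^bsub>G\<^esub> (?g u) \<otimes>\<^bsub>G\<^esub> s \<otimes>\<^bsub>G\<^esub> ?g u = s"
        using g[OF u] sc c by (simp add: m_assoc) (simp add: m_assoc[symmetric])
      ultimately show ?thesis using sS by simp
    qed
  qed
  have conj: "h \<otimes>\<^bsub>G\<^esub> s \<otimes>\<^bsub>G\<^esub> inv\<^bsub>G\<^esub> h \<in> S" if "h \<in> carrier G" "s \<in> S" for h s
  proof -
    have gens: "?g ` V \<subseteq> carrier G" using g by auto
    have "h \<in> generate G (?g ` V)" using that(1) by (simp add: G_def generate_vertex_gens)
    then show ?thesis using that(2)
    proof (induction arbitrary: s rule: generate.induct)
      case one
      then show ?case using S by auto
    next
      case (incl h)
      then show ?case using conj_gen by auto
    next
      case (inv h)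
      then show ?case using conj_gen g by auto
    next
      case (eng h1 h2)
      then have "h1 \<in> carrier G" "h2 \<in> carrier G" "s \<in> carrier G"
        using generate_in_carrier[OF gens] S by auto
      then have "h1 \<otimes>\<^bsub>G\<^esub> h2 \<otimes>\<^bsub>G\<^esub> s \<otimes>\<^bsub>G\<^esub> inv\<^bsub>G\<^esub> (h1 \<otimes>\<^bsub>G\<^esub> h2)
          = h1 \<otimes>\<^bsub>G\<^esub> (h2 \<otimes>\<^bsub>G\<^esub> s \<otimes>\<^bsub>G\<^esub> inv\<^bsub>G\<^esub> h2) \<otimes>\<^bsub>G\<^esub> inv\<^bsub>G\<^esub> h1"
        by (simp add: inv_mult_group m_assoc)
      then show ?case using eng by simp
    qed
  qed
  define A where "A = generate G S"
  have A: "A \<lhd> G" unfolding A_def by (rule normal_generateI[OF S conj])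
  have "derived G (carrier G) \<subseteq> A"
  proof (rule derived_subset_if_generators_commute_mod[OF A])
    show "generate G (?g ` V) = carrier G" by (simp add: G_def generate_vertex_gens)
    show "?g ` V \<subseteq> carrier G" using g by auto
    fix x y assume "x \<in> ?g ` V" "y \<in> ?g ` V"
    then obtain v w where vw: "v \<in> V" "w \<in> V" "x = ?g v" "y = ?g w" by auto
    show "x \<otimes>\<^bsub>G\<^esub> y \<otimes>\<^bsub>G\<^esub> inv\<^bsub>G\<^esub> x \<otimes>\<^bsub>G\<^esub> inv\<^bsub>G\<^esub> y \<in> A"
    proof (cases "N v w")
      case True
      then have "x \<otimes>\<^bsub>G\<^esub> y \<in> S" using vw by (auto simp: S_def)
      \<comment> \<open>\<open>x\<close> and \<open>y\<close> are involutions, so their commutator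
        is the square of \<open>x \<otimes> y\<close>.\<close>
      moreover have "x \<otimes>\<^bsub>G\<^esub> y \<otimes>\<^bsub>G\<^esub> inv\<^bsub>G\<^esub> x \<otimes>\<^bsub>G\<^esub> inv\<^bsub>G\<^esub> y = (x \<otimes>\<^bsub>G\<^esub> y) \<otimes>\<^bsub>G\<^esub> (x \<otimes>\<^bsub>G\<^esub> y)"
        using inv_g[OF True] inv_g[OF N_sym[OF True]] gN[OF True] vw by (simp add: m_assoc)
      ultimately show ?thesis unfolding A_def by (metis generate.eng generate.incl)
    next
      case False
      then have "x \<otimes>\<^bsub>G\<^esub> y = y \<otimes>\<^bsub>G\<^esub> x" using com vw by simp
      then have "x \<otimes>\<^bsub>G\<^esub> y \<otimes>\<^bsub>G\<^esub> inv\<^bsub>G\<^esub> x \<otimes>\<^bsub>G\<^esub> inv\<^bsub>G\<^esub> y = \<one>\<^bsub>G\<^esub>"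
        using g vw by (simp add: m_assoc)
      then show ?thesis unfolding A_def by (simp add: generate.one)
    qed
  qed
  then have "\<forall>x\<in>derived G (carrier G). \<forall>y\<in>derived G (carrier G). x \<otimes>\<^bsub>G\<^esub> y = y \<otimes>\<^bsub>G\<^esub> x"
    using generate_commute[OF S com_SS] unfolding A_def by blast
  then show ?thesis by (simp add: derived_trivial_iff_commute derived_in_carrier)
qed

section \<open>Join decompositions and the trichotomy for the derived length\<close>

lemma is_joinI:
  assumes E: "simplicial_graph V E" and V: "V1 \<noteq> {}" "V2 \<noteq> {}" "V = V1 \<union> V2" "V1 \<inter> V2 = {}"
    and adj: "\<And>v w. v \<in> V1 \<Longrightarrow> w \<in> V2 \<Longrightarrow> {v, w} \<in> E"
  shows "is_join V E"
proof -
  have "induced_subgraph W {e \<in> E. e \<subseteq> W} V E" if "W \<noteq> {}" "W \<subseteq> V" for W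
    using E that unfolding induced_subgraph_def simplicial_graph_def by blast
  then have "induced_subgraph V1 {e \<in> E. e \<subseteq> V1} V E" "induced_subgraph V2 {e \<in> E. e \<subseteq> V2} V E"
    using V by auto
  with V adj show ?thesis unfolding is_join_def by blast
qed

theorem theorem3p5:
  fixes V :: "'a set" and E :: "'a set set" and f :: "'a \<Rightarrow> enat"
  assumes "simplicial_graph V E" and "finite V" and "\<forall>v\<in>V. f v \<ge> 2"
  shows "derived_length (graph_product V E f) \<in> {1, 2, \<infinity>} \<and>
    (\<not> is_join V E \<longrightarrow>
      (derived_length (graph_product V E f) = 1 \<longleftrightarrow> (\<exists>v1. V = {v1})) \<and>
      (derived_length (graph_product V E f) = 2 \<longleftrightarrow>
        (\<exists>v w. v \<noteq> w \<and> V = {v, w} \<and> E = {} \<and> f v = 2 \<and> f w = 2)))"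
proof -
  let ?G = "graph_product V E f"
  interpret group ?G by (rule group_graph_product)
  have ne: "V \<noteq> {}" and edge: "\<And>e. e \<in> E \<Longrightarrow> \<exists>a b. e = {a, b} \<and> a \<in> V \<and> b \<in> V \<and> a \<noteq> b"
    using assms(1) unfolding simplicial_graph_def by blast+
  obtain v0 where v0: "v0 \<in> V" using ne by blast
  define N where "N v w \<longleftrightarrow> v \<in> V \<and> w \<in> V \<and> v \<noteq> w \<and> {v, w} \<notin> E" for v w
  have N_sym: "N w v" if "N v w" for v w using that by (auto simp: N_def insert_commute)
  \<comment> \<open>\<open>lab\<close> and \<open>uniq\<close> together say that the independent
    pairs form a matching with all labels 2.\<close>
  define lab where "lab \<longleftrightarrow> (\<forall>v w. N v w \<longrightarrow> f v = 2)"
  define uniq where "uniq \<longleftrightarrow> (\<forall>x y z. N x y \<longrightarrow> N x z \<longrightarrow> y = z)"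
  have complete: "derived_length ?G = 1" if "\<not> (\<exists>v w. N v w)"
  proof (rule derived_length_one)
    show "derived ?G (carrier ?G) = {\<one>\<^bsub>?G\<^esub>}"
      using that by (intro derived_complete_graph_product) (auto simp: N_def)
    show "carrier ?G \<noteq> {\<one>\<^bsub>?G\<^esub>}"
      using v0 assms(3) by (intro graph_product_nontrivial) auto
  qed
  have matching: "derived_length ?G = 2" if "\<exists>v w. N v w" lab uniq
  proof (rule derived_length_two)
    show "derived ?G (derived ?G (carrier ?G)) = {\<one>\<^bsub>?G\<^esub>}"
      using that(2,3) unfolding lab_def uniq_def N_def
      by (intro second_derived_trivial_of_matching) blast+
    from that(1) obtain v w where "N v w" by blast
    then show "derived ?G (carrier ?G) \<noteq> {\<one>\<^bsub>?G\<^esub>}"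
      using assms(3) by (intro derived_graph_product_nontrivial[of v V w]) (auto simp: N_def)
  qed
  have inf1: "derived_length ?G = \<infinity>" if "\<not> lab"
  proof -
    from that obtain v w where "N v w" "f v \<noteq> 2" by (auto simp: lab_def)
    then show ?thesis
      using assms(3) by (intro derived_length_infinite_of_label[of v V w]) (auto simp: N_def)
  qed
  have inf2: "derived_length ?G = \<infinity>" if lab "\<not> uniq"
  proof -
    from that(2) obtain x y z where xyz: "N x y" "N x z" "y \<noteq> z" by (auto simp: uniq_def)
    then have "f x = 2" "f y = 2" "f z = 2" using that(1) N_sym by (auto simp: lab_def)
    with xyz show ?thesis
      by (intro derived_length_infinite_of_two_nonneighbours[of x V y z E f]) (auto simp: N_def)
  qed
  \<comment> \<open>A failure of \<open>lab\<close> or \<open>uniq\<close> already exhibits an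
    independent pair, so the three cases below are exclusive and each is characterized by its
    derived length.\<close>
  have ex: "\<exists>v w. N v w" if "\<not> lab \<or> \<not> uniq" using that unfolding lab_def uniq_def by blast
  consider "\<not> (\<exists>v w. N v w)" "derived_length ?G = 1"
    | "\<exists>v w. N v w" lab uniq "derived_length ?G = 2"
    | "\<exists>v w. N v w" "\<not> (lab \<and> uniq)" "derived_length ?G = \<infinity>"
    using complete matching inf1 inf2 ex by metis
  then have dl: "derived_length ?G \<in> {1, 2, \<infinity>}"
    and dl1: "derived_length ?G = 1 \<longleftrightarrow> \<not> (\<exists>v w. N v w)"
    and dl2: "derived_length ?G = 2 \<longleftrightarrow> (\<exists>v w. N v w) \<and> lab \<and> uniq"
    by (cases; simp add: numeral_eq_enat one_enat_def)+
  note dl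
  moreover have "\<not> (\<exists>v w. N v w) \<longleftrightarrow> (\<exists>v1. V = {v1})" if nj: "\<not> is_join V E"
  proof
    assume noN: "\<not> (\<exists>v w. N v w)"
    from ne obtain v where v: "v \<in> V" by blast
    have "V - {v} = {}"
    proof (rule ccontr)
      assume "V - {v} \<noteq> {}"
      \<comment> \<open>In a complete graph any single vertex splits off as a join factor.\<close>
      with v noN have "is_join V E"
        by (intro is_joinI[OF assms(1), of "{v}" "V - {v}"]) (auto simp: N_def)
      with nj show False by blast
    qed
    with v show "\<exists>v1. V = {v1}" by blast
  qed (auto simp: N_def)
  moreover have "(\<exists>v w. N v w) \<and> lab \<and> uniq \<longleftrightarrow>
      (\<exists>v w. v \<noteq> w \<and> V = {v, w} \<and> E = {} \<and> f v = 2 \<and> f w = 2)" if nj: "\<not> is_join V E"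
  proof
    assume *: "(\<exists>v w. N v w) \<and> lab \<and> uniq"
    then obtain v w where vw: "N v w" by blast
    have "V - {v, w} = {}"
    proof (rule ccontr)
      assume ne': "V - {v, w} \<noteq> {}"
      \<comment> \<open>By \<open>uniq\<close>, a vertex outside the matched pair is adjacent to
        both of its members, so the pair would split off as a join factor.\<close>
      have "{a, b} \<in> E" if "a \<in> {v, w}" "b \<in> V - {v, w}" for a b
      proof (rule ccontr)
        assume "{a, b} \<notin> E"
        then have "N a b" using that vw by (auto simp: N_def)
        moreover have "N v w" "N w v" using vw N_sym by blast+
        ultimately have "b = w \<or> b = v" using * that(1) unfolding uniq_def by blast
        with that(2) show False by blast
      qed
      with ne' vw have "is_join V E"
        by (intro is_joinI[OF assms(1), of "{v, w}" "V - {v, w}"]) (auto simp: N_def)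
      with nj show False by blast
    qed
    then have V: "V = {v, w}" using vw by (auto simp: N_def)
    moreover have "E = {}"
    proof (rule ccontr)
      assume "E \<noteq> {}"
      then obtain e where "e \<in> E" by blast
      from edge[OF this] obtain a b where "e = {a, b}" "a \<in> {v, w}" "b \<in> {v, w}" "a \<noteq> b"
        unfolding V by blast
      then have "e = {v, w}" by blast
      with \<open>e \<in> E\<close> have "{v, w} \<in> E" by simp
      with vw show False by (simp add: N_def)
    qed
    moreover have "f v = 2" "f w = 2" using * vw N_sym[OF vw] unfolding lab_def by blast+
    ultimately show "\<exists>v w. v \<noteq> w \<and> V = {v, w} \<and> E = {} \<and> f v = 2 \<and> f w = 2"
      using vw by (intro exI[of _ v] exI[of _ w]) (simp add: N_def)
  next
    assume "\<exists>v w. v \<noteq> w \<and> V = {v, w} \<and> E = {} \<and> f v = 2 \<and> f w = 2"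
    then obtain v w where vw: "v \<noteq> w" "V = {v, w}" "E = {}" "f v = 2" "f w = 2" by blast
    then have "N a b \<longleftrightarrow> a = v \<and> b = w \<or> a = w \<and> b = v" for a b by (auto simp: N_def)
    with vw show "(\<exists>v w. N v w) \<and> lab \<and> uniq" by (auto simp: lab_def uniq_def)
  qed
  ultimately show ?thesis using dl1 dl2 by simp
qed

end
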